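(* Let $\mathcal{G}=(V,E,\Phi,\chi)$ be a random decision network with $|\chi|=T$ satisfying the following two assumptions. (1) For all $v\in V$ and $x\neq y$ in $\chi$, $B_{\mathcal{G},v}(x)-B_{\mathcal{G},v}(y)$ is a continuous random variable with density bounded above by a constant $g>0$. (2) There is $K_\Phi$ such that $\big(\sum_{x,y\in\chi}\mathbb{E}|\Phi_e(x,y)|^2\big)^{1/2}\le K_\Phi$ for every $e\in E$ and $\big(\sum_{x\in\chi}\mathbb{E}|\Phi_v(x)|^2\big)^{1/2}\le K_\Phi$ for every $v\in V$. Let $\mathbf{x}$ be the (almost surely unique) optimal solution of $\mathcal{G}$, and for each $r$ let $\mathbf{x}^r=(x^r_v)_{v\in V}$ with $x^r_v\in\arg\max_{x\in\chi}\mathrm{CE}[\mathcal{G},v,r,x]$, ties broken arbitrarily. Let $K_1=10K_\Phi T(|V|+|E|)$. Suppose $\mathcal{G}$ satisfies the correlation decay property with rate $\rho(r)$. Then, for all $r>0$, $$\mathbb{E}[F_{\mathcal{G}}(\mathbf{x})-F_{\mathcal{G}}(\mathbf{x}^{r})]\le K_1\,(g\rho(r))^{1/4}.$$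
   Context: A decision network $\mathcal{G}=(V,E,\Phi,\chi)$ consists of a finite undirected simple graph $(V,E)$, an action set $\chi=\{0,\ldots,T-1\}$, potential functions $\Phi_v:\chi\to\mathbb{R}$ ($v\in V$) and interaction functions $\Phi_e:\chi^2\to\mathbb{R}\cup\{-\infty\}$ ($e\in E$); here $\Phi$ is random. $F_{\mathcal{G}}(\mathbf{x})=\sum_{(u,v)\in E}\Phi_{u,v}(x_u,x_v)+\sum_{v}\Phi_v(x_v)$; a solution is optimal if it maximizes $F_{\mathcal{G}}$; $J_{\mathcal{G},v}(x)=\max_{\mathbf{x}:x_v=x}F_{\mathcal{G}}(\mathbf{x})$; the cavity is $B_{\mathcal{G},v}(x)=J_{\mathcal{G},v}(x)-J_{\mathcal{G},v}(0)$. Partial cavity function: $\mu_{u\leftarrow v}(x,B)=\max_{y}(\Phi_{u,v}(x,y)+B(y))-\max_{y}(\Phi_{u,v}(0,y)+B(y))$ for a vector $B=(B(y))_{y\in\chi}$. For a node $u$ with neighbors $v_1,\ldots,v_d$ (in a fixed order), $\mathcal{G}(u,j,x)$ is the decision network on the subgraph induced by $V\setminus\{u\}$ with the same interaction functions on the remaining edges and potentials $\Phi'_v(y)=\Phi_v(y)+\Phi_{u,v}(x,y)$ for $v\in\{v_1,\ldots,v_{j-1}\}$, $\Phi'_v(y)=\Phi_v(y)+\Phi_{u,v}(0,y)$ for $v\in\{v_{j+1},\ldots,v_d\}$, and $\Phi'_v=\Phi_v$ otherwise. Cavity Expansion (CE): $\mathrm{CE}[\mathcal{G},u,0,x]=0$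 and for $r\ge1$, $\mathrm{CE}[\mathcal{G},u,r,x]=\Phi_u(x)-\Phi_u(0)+\sum_{j=1}^d\mu_{u\leftarrow v_j}\big(x,\mathrm{CE}[\mathcal{G}(u,j,x),v_j,r-1]\big)$, where $\mathrm{CE}[\cdot,\cdot,r-1]$ is the vector over actions and the sum is $0$ if $u$ has no neighbors. Unrolling the recursion, let $(\mathcal{G}_i,v_i,0,x_i)_{i}$ be the depth-$0$ calls used in computing $\mathrm{CE}[\mathcal{G},u,r,x]$. A boundary condition $\mathcal{C}=(\mathcal{C}_i)_i$ assigns to the $i$-th such call a value $\mathcal{C}_i$ to be returned in place of $0$ (a constant, or a quantity determined by the network $\mathcal{G}_i$, such as the "true boundary condition" $\mathcal{C}^*_i=B_{\mathcal{G}_i,v_i}(x_i)$); the output is denoted $\mathrm{CE}[\mathcal{G},u,r,x,\mathcal{C}]$. Given $\rho(r)\ge0$ with $\lim_{r\to\infty}\rho(r)=0$, $\mathcal{G}$ satisfies the correlation decay property with rate $\rho$ if for every $r\ge1$ and every two boundary conditions $\mathcal{C},\mathcal{C}'$, $\max_{u,x}\mathbb{E}\big|\mathrm{CE}[\mathcal{G},u,r,x,\mathcal{C}]-\mathrm{CE}[\mathcal{G},u,r,x,\mathcal{C}']\big|\le\rho(r)$. In particular $\mathbb{E}|\mathrm{CE}[\mathcal{G},u,r,x]-B_{\mathcal{G},u}(x)|\le\rho(r)$ for all $u,x$ and $r\ge1$. *)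

theory Defs
  imports "HOL-Probability.Probability"
begin

text \<open>
  The edge set contains every undirected edge exactly once, as a pair with an arbitrary reference
  orientation (hence asymmetry below); the orientation only fixes the order of the two arguments
  of the interaction function of the edge.  The action set is \<open>{..<nact G}\<close>.
  Node potentials have extended real values, because they may become \<open>-\<infinity>\<close> in the subnetworks
  below, where interactions are added to them.
\<close>

record 'v network =
  verts :: "'v set"
  edges :: "('v \<times> 'v) set"
  nact  :: nat
  vpot  :: "'v \<Rightarrow> nat \<Rightarrow> ereal"
  epot  :: "'v \<times> 'v \<Rightarrow> nat \<Rightarrow> nat \<Rightarrow> ereal"

definition decision_network :: "'v network \<Rightarrow> bool" where
  "decision_network G \<longleftrightarrow>
     finite (verts G) \<and> edges G \<subseteq> verts G \<times> verts G \<and> asym (edges G) \<and> nact G \<ge> 1 \<and>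
     (\<forall>v\<in>verts G. \<forall>x<nact G. \<bar>vpot G v x\<bar> \<noteq> \<infinity>) \<and>
     (\<forall>e\<in>edges G. \<forall>x<nact G. \<forall>y<nact G. epot G e x y \<noteq> \<infinity>)"

definition interaction :: "'v network \<Rightarrow> 'v \<Rightarrow> 'v \<Rightarrow> nat \<Rightarrow> nat \<Rightarrow> ereal" where
  "interaction G u v x y = (if (u, v) \<in> edges G then epot G (u, v) x y else epot G (v, u) y x)"

definition solutions :: "'v network \<Rightarrow> ('v \<Rightarrow> nat) set" where
  "solutions G = verts G \<rightarrow>\<^sub>E {..<nact G}"

definition objective :: "'v network \<Rightarrow> ('v \<Rightarrow> nat) \<Rightarrow> ereal" where
  "objective G x = (\<Sum>(u, v)\<in>edges G. epot G (u, v) (x u) (x v)) + (\<Sum>v\<in>verts G. vpot G v (x v))"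

definition optimal :: "'v network \<Rightarrow> ('v \<Rightarrow> nat) \<Rightarrow> bool" where
  "optimal G x \<longleftrightarrow> is_arg_max (objective G) (\<lambda>x. x \<in> solutions G) x"

definition max_objective :: "'v network \<Rightarrow> 'v \<Rightarrow> nat \<Rightarrow> ereal" where
  "max_objective G v a = Max (objective G ` {x \<in> solutions G. x v = a})"

definition cavity :: "'v network \<Rightarrow> 'v \<Rightarrow> nat \<Rightarrow> ereal" where
  "cavity G v a = max_objective G v a - max_objective G v 0"

definition partial_cavity :: "'v network \<Rightarrow> 'v \<Rightarrow> 'v \<Rightarrow> nat \<Rightarrow> (nat \<Rightarrow> ereal) \<Rightarrow> ereal" where
  "partial_cavity G u v x B =
     Max ((\<lambda>y. interaction G u v x y + B y) ` {..<nact G})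
     - Max ((\<lambda>y. interaction G u v 0 y + B y) ` {..<nact G})"

text \<open>
  An order \<open>nb W u\<close> of the neighbours of \<open>u\<close> is fixed for every subgraph induced by a set \<open>W\<close>
  of nodes and every node \<open>u\<close> of it.
\<close>

definition neighbour_order :: "'v set \<Rightarrow> ('v \<times> 'v) set \<Rightarrow> ('v set \<Rightarrow> 'v \<Rightarrow> 'v list) \<Rightarrow> bool" where
  "neighbour_order V E nb \<longleftrightarrow>
     (\<forall>W\<subseteq>V. \<forall>u\<in>W. distinct (nb W u) \<and> set (nb W u) = {v \<in> W. (u, v) \<in> E \<or> (v, u) \<in> E})"

text \<open>Positions \<open>j\<close> in the list of neighbours are counted from \<open>0\<close>.\<close>

definition subnetwork ::
    "('v set \<Rightarrow> 'v \<Rightarrow> 'v list) \<Rightarrow> 'v network \<Rightarrow> 'v \<Rightarrow> nat \<Rightarrow> nat \<Rightarrow> 'v network" where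
  "subnetwork nb G u j x =
     (let vs = nb (verts G) u in
      \<lparr> verts = verts G - {u},
        edges = {(a, b) \<in> edges G. a \<noteq> u \<and> b \<noteq> u},
        nact = nact G,
        vpot = (\<lambda>v y. if v \<in> set (take j vs) then vpot G v y + interaction G u v x y
                      else if v \<in> set (drop (Suc j) vs) then vpot G v y + interaction G u v 0 y
                      else vpot G v y),
        epot = epot G \<rparr>)"

text \<open>
  The call with arguments \<open>G, u, Suc r, x\<close> makes, for every neighbour position \<open>j\<close> and every action
  \<open>y\<close>, one recursive call.  A call in the unrolled recursion is therefore identified by the list of
  the choices \<open>(j, y)\<close> that lead to it.  In \<open>CE_boundary\<close> the depth-0 call identified by \<open>p\<close>
  returns \<open>c p\<close>.
\<close>

type_synonym call = "(nat \<times> nat) list"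

fun CE_boundary ::
    "('v set \<Rightarrow> 'v \<Rightarrow> 'v list) \<Rightarrow> 'v network \<Rightarrow> 'v \<Rightarrow> nat \<Rightarrow> nat \<Rightarrow> (call \<Rightarrow> ereal) \<Rightarrow> ereal" where
  "CE_boundary nb G u 0 x c = c []"
| "CE_boundary nb G u (Suc r) x c =
     vpot G u x - vpot G u 0
     + (\<Sum>j<length (nb (verts G) u).
          partial_cavity G u (nb (verts G) u ! j) x
            (\<lambda>y. CE_boundary nb (subnetwork nb G u j x) (nb (verts G) u ! j) r y
                   (\<lambda>p. c ((j, y) # p))))"

definition CE :: "('v set \<Rightarrow> 'v \<Rightarrow> 'v list) \<Rightarrow> 'v network \<Rightarrow> 'v \<Rightarrow> nat \<Rightarrow> nat \<Rightarrow> ereal" where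
  "CE nb G u r x = CE_boundary nb G u r x (\<lambda>_. 0)"

text \<open>
  \<open>depth0_calls nb T W u r\<close> are the depth-0 calls in a computation of depth \<open>r\<close> at node \<open>u\<close> of a
  network with node set \<open>W\<close>; \<open>call_network nb G u x p\<close> is the network passed to the call \<open>p\<close>.
\<close>

fun depth0_calls :: "('v set \<Rightarrow> 'v \<Rightarrow> 'v list) \<Rightarrow> nat \<Rightarrow> 'v set \<Rightarrow> 'v \<Rightarrow> nat \<Rightarrow> call set" where
  "depth0_calls nb T W u 0 = {[]}"
| "depth0_calls nb T W u (Suc r) =
     (\<Union>j<length (nb W u). \<Union>y<T. (#) (j, y) ` depth0_calls nb T (W - {u}) (nb W u ! j) r)"

fun call_network ::
    "('v set \<Rightarrow> 'v \<Rightarrow> 'v list) \<Rightarrow> 'v network \<Rightarrow> 'v \<Rightarrow> nat \<Rightarrow> call \<Rightarrow> 'v network" where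
  "call_network nb G u x [] = G"
| "call_network nb G u x ((j, y) # p) =
     call_network nb (subnetwork nb G u j x) (nb (verts G) u ! j) y p"

text \<open>Random networks: the graph and the action set are deterministic, the potentials are random.\<close>

definition random_decision_network ::
    "'w measure \<Rightarrow> ('w \<Rightarrow> 'v network) \<Rightarrow> 'v set \<Rightarrow> ('v \<times> 'v) set \<Rightarrow> nat \<Rightarrow> bool" where
  "random_decision_network M G V E T \<longleftrightarrow>
     prob_space M \<and>
     (\<forall>\<omega>\<in>space M. decision_network (G \<omega>) \<and>
        verts (G \<omega>) = V \<and> edges (G \<omega>) = E \<and> nact (G \<omega>) = T) \<and>
     (\<forall>v\<in>V. \<forall>x<T. (\<lambda>\<omega>. vpot (G \<omega>) v x) \<in> borel_measurable M) \<and>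
     (\<forall>e\<in>E. \<forall>x<T. \<forall>y<T. (\<lambda>\<omega>. epot (G \<omega>) e x y) \<in> borel_measurable M)"

text \<open>The sigma-algebra generated by a random network.\<close>

definition network_sigma :: "'w measure \<Rightarrow> ('w \<Rightarrow> 'v network) \<Rightarrow> 'w measure" where
  "network_sigma M H = sigma (space M)
     ({{\<omega> \<in> space M. v \<in> verts (H \<omega>) \<and> x < nact (H \<omega>) \<and> vpot (H \<omega>) v x \<in> A} | v x A.
         A \<in> sets borel} \<union>
      {{\<omega> \<in> space M. e \<in> edges (H \<omega>) \<and> x < nact (H \<omega>) \<and> y < nact (H \<omega>) \<and>
           epot (H \<omega>) e x y \<in> A} | e x y A. A \<in> sets borel})"

text \<open>
  The value assigned to a depth-0 call is a random variable that is determined by the network passed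
  to that call, i.e. measurable with respect to the sigma-algebra this network generates (constants
  in particular).
\<close>

definition boundary_condition ::
    "'w measure \<Rightarrow> ('v set \<Rightarrow> 'v \<Rightarrow> 'v list) \<Rightarrow> ('w \<Rightarrow> 'v network) \<Rightarrow> 'v set \<Rightarrow> nat \<Rightarrow>
     'v \<Rightarrow> nat \<Rightarrow> nat \<Rightarrow> (call \<Rightarrow> 'w \<Rightarrow> ereal) \<Rightarrow> bool" where
  "boundary_condition M nb G V T u r x C \<longleftrightarrow>
     (\<forall>p\<in>depth0_calls nb T V u r.
        C p \<in> borel_measurable (network_sigma M (\<lambda>\<omega>. call_network nb (G \<omega>) u x p)) \<and>
        (AE \<omega> in M. \<bar>C p \<omega>\<bar> \<noteq> \<infinity>))"

definition correlation_decay ::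
    "'w measure \<Rightarrow> ('v set \<Rightarrow> 'v \<Rightarrow> 'v list) \<Rightarrow> ('w \<Rightarrow> 'v network) \<Rightarrow> 'v set \<Rightarrow> nat \<Rightarrow>
     (nat \<Rightarrow> real) \<Rightarrow> bool" where
  "correlation_decay M nb G V T \<rho> \<longleftrightarrow>
     (\<forall>r. 0 \<le> \<rho> r) \<and> \<rho> \<longlonglongrightarrow> 0 \<and>
     (\<forall>r\<ge>1. \<forall>u\<in>V. \<forall>x<T. \<forall>C C'.
        boundary_condition M nb G V T u r x C \<and> boundary_condition M nb G V T u r x C' \<longrightarrow>
        (\<integral>\<^sup>+\<omega>. e2ennreal \<bar>CE_boundary nb (G \<omega>) u r x (\<lambda>p. C p \<omega>)
                        - CE_boundary nb (G \<omega>) u r x (\<lambda>p. C' p \<omega>)\<bar> \<partial>M) \<le> ennreal (\<rho> r))"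

definition density_bounded_by :: "'w measure \<Rightarrow> ('w \<Rightarrow> ereal) \<Rightarrow> real \<Rightarrow> bool" where
  "density_bounded_by M X g \<longleftrightarrow>
     (AE \<omega> in M. \<bar>X \<omega>\<bar> \<noteq> \<infinity>) \<and>
     (\<exists>f. distributed M lborel (\<lambda>\<omega>. real_of_ereal (X \<omega>)) f \<and> (\<forall>t. f t \<le> ennreal g))"

definition L2_bounded_by :: "'w measure \<Rightarrow> 'i set \<Rightarrow> ('i \<Rightarrow> 'w \<Rightarrow> ereal) \<Rightarrow> real \<Rightarrow> bool" where
  "L2_bounded_by M I X K \<longleftrightarrow>
     (\<Sum>i\<in>I. \<integral>\<^sup>+\<omega>. e2ennreal (\<bar>X i \<omega>\<bar> ^ 2) \<partial>M) < \<infinity> \<and>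
     sqrt (enn2real (\<Sum>i\<in>I. \<integral>\<^sup>+\<omega>. e2ennreal (\<bar>X i \<omega>\<bar> ^ 2) \<partial>M)) \<le> K"

end

theory Submission
  imports Defs
begin

text \<open>
  The cavity of a node is, up to an additive constant, the best objective value for each of its
  actions, so an optimal solution maximises every cavity (\<open>optimal_maximizes_cavity\<close>).  The cavity
  satisfies the very recursion by which the cavity expansion is defined (\<open>cavity_recursion\<close>: change
  the action that the neighbours see from \<open>0\<close> to \<open>x\<close> one neighbour at a time and telescope).
  Consequently the expansion returns the exact cavity when its depth-0 calls return the exact
  cavities of their networks (\<open>CE_boundary_true_boundary\<close>).  This true boundary condition is
  admissible in the correlation decay property, which therefore bounds the mean distance between
  the expansion and the cavity by \<open>\<rho> r\<close> (\<open>expected_CE_error\<close>).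

  A node at which the two maximisers differ has two actions whose cavities are within \<open>\<epsilon>\<close> of each
  other, or an action at which the expansion is off by at least \<open>\<epsilon> / 2\<close>.  The density bound and
  Markov's inequality bound the probabilities of these events by multiples of \<open>g * \<epsilon>\<close> and
  \<open>\<rho> r / \<epsilon>\<close>.  With \<open>\<epsilon> = sqrt (\<rho> r / g)\<close> a wrong decision has a probability of order
  \<open>T\<^sup>2 * sqrt (g * \<rho> r)\<close> (\<open>argmax_unchanged_off_small_event\<close>).

  Finally, the two solutions differ in the objective only by the terms of those nodes and edges that
  touch a wrong decision (\<open>objective_gap_le\<close>).  By the Cauchy--Schwarz inequality
  (\<open>nn_integral_Max_on_event\<close>) each such term has an expectation of at most a constant times \<open>K\<close> and
  the square root of the above probability, which is where the exponent \<open>1 / 4\<close> comes from.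
\<close>

section \<open>Extended reals that are real\<close>

text \<open>
  An opaque name for finiteness: the simplifier rewrites \<open>\<bar>a\<bar> \<noteq> \<infinity>\<close> into an
  existential statement, which would keep the closure rules below from being applied.
\<close>

definition is_real :: "ereal \<Rightarrow> bool" where
  "is_real a \<longleftrightarrow> \<bar>a\<bar> \<noteq> \<infinity>"

section \<open>Finite networks and their cavities\<close>

text \<open>
  A second moment is finite only if the variable is almost surely real.  The moment bounds on the
  potentials therefore make almost every realisation of the random network finite in this sense, and
  differences of maxima then obey the rules of real arithmetic.
\<close>

definition finite_network :: "'v network \<Rightarrow> bool" where
  "finite_network G \<longleftrightarrow>
     finite (verts G) \<and> edges G \<subseteq> verts G \<times> verts G \<and> asym (edges G) \<and> 0 < nact G \<and>
     (\<forall>v\<in>verts G. \<forall>x<nact G. is_real (vpot G v x)) \<and>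
     (\<forall>e\<in>edges G. \<forall>x<nact G. \<forall>y<nact G. is_real (epot G e x y))"

lemma finite_networkD:
  assumes "finite_network G"
  shows "finite (verts G)" "finite (edges G)" "edges G \<subseteq> verts G \<times> verts G" "asym (edges G)"
    "0 < nact G"
    "\<And>v x. v \<in> verts G \<Longrightarrow> x < nact G \<Longrightarrow> is_real (vpot G v x)"
    "\<And>e x y. e \<in> edges G \<Longrightarrow> x < nact G \<Longrightarrow> y < nact G \<Longrightarrow> is_real (epot G e x y)"
  using assms unfolding finite_network_def
  by (auto intro: finite_subset[of _ "verts G \<times> verts G"])

lemma finite_networkI:
  assumes "decision_network G"
    and "\<And>e x y. e \<in> edges G \<Longrightarrow> x < nact G \<Longrightarrow> y < nact G \<Longrightarrow> is_real (epot G e x y)"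
  shows "finite_network G"
  using assms unfolding finite_network_def decision_network_def is_real_def by auto

lemma is_real_0: "is_real 0"
  by (simp add: is_real_def)

lemma is_real_add:
  fixes a b :: ereal
  shows "is_real a \<Longrightarrow> is_real b \<Longrightarrow> is_real (a + b)"
  by (cases a; cases b) (auto simp: is_real_def)

lemma is_real_diff:
  fixes a b :: ereal
  shows "is_real a \<Longrightarrow> is_real b \<Longrightarrow> is_real (a - b)"
  by (cases a; cases b) (auto simp: is_real_def)

lemma is_real_sum:
  fixes f :: "'a \<Rightarrow> ereal"
  assumes "\<And>a. a \<in> A \<Longrightarrow> is_real (f a)"
  shows "is_real (sum f A)"
  using assms by (induction A rule: infinite_finite_induct) (auto intro: is_real_add is_real_0)

lemma is_real_Max:
  fixes f :: "'a \<Rightarrow> ereal"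
  assumes "finite A" "A \<noteq> {}" "\<And>a. a \<in> A \<Longrightarrow> is_real (f a)"
  shows "is_real (Max (f ` A))"
  using Max_in[of "f ` A"] assms by fastforce

lemma Max_add_left_ereal:
  fixes c :: ereal
  assumes "finite A" "A \<noteq> {}"
  shows "Max ((\<lambda>a. c + f a) ` A) = c + Max (f ` A)"
proof -
  have "mono ((+) c)" by (intro monoI add_left_mono)
  from mono_Max_commute[OF this, of "f ` A"] assms show ?thesis
    by (simp add: image_image)
qed

text \<open>
  Maximising in two stages: \<open>p\<close> will read off the action of one node, so that the inner maxima are
  taken over the solutions with a prescribed action there.
\<close>

lemma Max_fibres:
  fixes f :: "'a \<Rightarrow> 'c::linorder"
  assumes "finite S" "p ` S = Y" "Y \<noteq> {}"
  shows "Max (f ` S) = Max ((\<lambda>y. Max (f ` {z \<in> S. p z = y})) ` Y)"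
proof (rule antisym)
  have Y: "finite Y" using assms by auto
  show "Max (f ` S) \<le> Max ((\<lambda>y. Max (f ` {z \<in> S. p z = y})) ` Y)"
  proof (rule Max.boundedI)
    fix a assume "a \<in> f ` S"
    then obtain z where z: "z \<in> S" "a = f z" by auto
    have "f z \<le> Max (f ` {z' \<in> S. p z' = p z})" using z assms by (intro Max_ge) auto
    also have "\<dots> \<le> Max ((\<lambda>y. Max (f ` {z \<in> S. p z = y})) ` Y)"
      using z assms Y by (intro Max_ge) auto
    finally show "a \<le> Max ((\<lambda>y. Max (f ` {z \<in> S. p z = y})) ` Y)" using z by simp
  qed (use assms in auto)
  have "Max (f ` {z \<in> S. p z = y}) \<le> Max (f ` S)" if "y \<in> Y" for y
    using that assms by (intro Max_mono) auto
  then show "Max ((\<lambda>y. Max (f ` {z \<in> S. p z = y})) ` Y) \<le> Max (f ` S)"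
    using Y assms by (intro Max.boundedI) auto
qed

lemma solutions_value: "z \<in> solutions G \<Longrightarrow> v \<in> verts G \<Longrightarrow> z v < nact G"
  unfolding solutions_def by (auto dest: PiE_mem)

lemma finite_solutions: "finite_network G \<Longrightarrow> finite (solutions G)"
  unfolding solutions_def by (intro finite_PiE) (auto dest: finite_networkD)

lemma solutions_with_action_nonempty:
  assumes "v \<in> verts G" "a < nact G"
  shows "{z \<in> solutions G. z v = a} \<noteq> {}"
proof -
  have "(\<lambda>w\<in>verts G. a) \<in> {z \<in> solutions G. z v = a}"
    using assms by (auto simp: solutions_def)
  then show ?thesis by blast
qed

lemma objective_finite:
  assumes "finite_network G" "z \<in> solutions G"
  shows "is_real (objective G z)"
  unfolding objective_def
  using finite_networkD[OF assms(1)] solutions_value[OF assms(2)]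
  by (intro is_real_add is_real_sum) auto

lemma max_objective_finite:
  assumes "finite_network G" "v \<in> verts G" "a < nact G"
  shows "is_real (max_objective G v a)"
  unfolding max_objective_def
  using finite_solutions[OF assms(1)] solutions_with_action_nonempty[OF assms(2,3)]
    objective_finite[OF assms(1)]
  by (intro is_real_Max) auto

lemma cavity_finite:
  assumes "finite_network G" "v \<in> verts G" "a < nact G"
  shows "is_real (cavity G v a)"
  unfolding cavity_def using assms finite_networkD(5)[OF assms(1)]
  by (intro is_real_diff max_objective_finite) auto

text \<open>
  The cavity of \<open>v\<close> is, up to a constant, the best objective value for a given action of \<open>v\<close>.  Exact
  cavities therefore determine the optimal solution node by node wherever their maximisers are unique.
\<close>

lemma optimal_maximizes_cavity:
  assumes "finite_network G" "optimal G x" "v \<in> verts G" "b < nact G"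
  shows "cavity G v b \<le> cavity G v (x v)"
proof -
  have x: "x \<in> solutions G" and opt: "\<And>z. z \<in> solutions G \<Longrightarrow> objective G z \<le> objective G x"
    using assms(2) unfolding optimal_def is_arg_max_def by (auto simp: not_less)
  have "max_objective G v b \<le> objective G x"
    unfolding max_objective_def
    using finite_solutions[OF assms(1)] solutions_with_action_nonempty[OF assms(3,4)] opt
    by (intro Max.boundedI) auto
  also have "\<dots> \<le> max_objective G v (x v)"
    unfolding max_objective_def using finite_solutions[OF assms(1)] x by (intro Max_ge) auto
  finally show ?thesis unfolding cavity_def by (intro ereal_minus_mono) auto
qed

section \<open>The cavity recursion\<close>

lemma interaction_finite:
  assumes "finite_network G" "(u, v) \<in> edges G \<or> (v, u) \<in> edges G" "a < nact G" "b < nact G"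
  shows "is_real (interaction G u v a b)"
  using finite_networkD(7)[OF assms(1)] assms unfolding interaction_def by auto

lemma subnetwork_select [simp]:
  "verts (subnetwork nb G u j x) = verts G - {u}"
  "edges (subnetwork nb G u j x) = {(a, b) \<in> edges G. a \<noteq> u \<and> b \<noteq> u}"
  "nact (subnetwork nb G u j x) = nact G"
  "epot (subnetwork nb G u j x) = epot G"
  by (simp_all add: subnetwork_def Let_def)

lemma neighbour_orderD:
  assumes "neighbour_order V E nb" "u \<in> V"
  shows "distinct (nb V u)" "set (nb V u) = {v \<in> V. (u, v) \<in> E \<or> (v, u) \<in> E}"
  using assms unfolding neighbour_order_def by blast+

lemma neighbours_remaining:
  assumes "neighbour_order V E nb" "asym E" "u \<in> V"
  shows "set (nb V u) \<subseteq> V - {u}"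
proof -
  have "(u, u) \<notin> E" using assms(2) by (blast dest: asymD)
  then show ?thesis using neighbour_orderD(2)[OF assms(1,3)] by auto
qed

lemma neighbour_order_remove:
  assumes "neighbour_order V E nb"
  shows "neighbour_order (V - {u}) {(a, b) \<in> E. a \<noteq> u \<and> b \<noteq> u} nb"
  unfolding neighbour_order_def
proof (intro allI impI ballI)
  fix W w assume W: "W \<subseteq> V - {u}" "w \<in> W"
  then have "distinct (nb W w) \<and> set (nb W w) = {v \<in> W. (w, v) \<in> E \<or> (v, w) \<in> E}"
    using assms unfolding neighbour_order_def by blast
  moreover have "{v \<in> W. (w, v) \<in> E \<or> (v, w) \<in> E} = {v \<in> W.
      (w, v) \<in> {(a, b) \<in> E. a \<noteq> u \<and> b \<noteq> u} \<or> (v, w) \<in> {(a, b) \<in> E. a \<noteq> u \<and> b \<noteq> u}}"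
    using W by auto
  ultimately show "distinct (nb W w) \<and> set (nb W w) = {v \<in> W.
      (w, v) \<in> {(a, b) \<in> E. a \<noteq> u \<and> b \<noteq> u} \<or> (v, w) \<in> {(a, b) \<in> E. a \<noteq> u \<and> b \<noteq> u}}"
    by simp
qed

lemma finite_network_subnetwork:
  assumes "finite_network G" "neighbour_order (verts G) (edges G) nb" "u \<in> verts G" "x < nact G"
  shows "finite_network (subnetwork nb G u j x)"
proof -
  note fin = finite_networkD[OF assms(1)]
  have int: "is_real (interaction G u v a y)"
    if "v \<in> set (nb (verts G) u)" "a < nact G" "y < nact G" for v a y
    using that neighbour_orderD[OF assms(2,3)] by (intro interaction_finite[OF assms(1)]) auto
  have "is_real (vpot (subnetwork nb G u j x) v y)" if "v \<in> verts G" "y < nact G" for v y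
    unfolding subnetwork_def Let_def
    using that fin(5,6) int assms(4)
    by (auto intro!: is_real_add dest: in_set_takeD in_set_dropD)
  moreover have "asym {(a, b) \<in> edges G. a \<noteq> u \<and> b \<noteq> u}"
    using fin(4) by (auto simp: asym_on_def)
  ultimately show ?thesis
    using fin unfolding finite_network_def by auto
qed

definition objective_without :: "'v network \<Rightarrow> 'v \<Rightarrow> ('v \<Rightarrow> nat) \<Rightarrow> ereal" where
  "objective_without G u z =
     (\<Sum>(a, b)\<in>{(a, b) \<in> edges G. a \<noteq> u \<and> b \<noteq> u}. epot G (a, b) (z a) (z b))
     + (\<Sum>v\<in>verts G - {u}. vpot G v (z v))"

text \<open>
  The objective on \<open>V - {u}\<close> that results when the first \<open>k\<close> neighbours of \<open>u\<close> see the action \<open>x\<close> at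
  \<open>u\<close> and the other ones see the action \<open>0\<close>.  It interpolates between the two networks that are
  compared in the cavity \<open>J(x) - J(0)\<close>: for \<open>k = 0\<close> all neighbours see \<open>0\<close>, for the largest \<open>k\<close> all
  see \<open>x\<close>.
\<close>

definition hybrid_objective ::
    "'v network \<Rightarrow> 'v \<Rightarrow> 'v list \<Rightarrow> nat \<Rightarrow> nat \<Rightarrow> ('v \<Rightarrow> nat) \<Rightarrow> ereal" where
  "hybrid_objective G u vs x k z = objective_without G u z
     + (\<Sum>i<length vs. interaction G u (vs ! i) (if i < k then x else 0) (z (vs ! i)))"

text \<open>
  The function \<open>interaction\<close> undoes the arbitrary orientation of the edges, and asymmetry guarantees
  that no edge is counted twice.
\<close>

lemma sum_incident_edges:
  assumes "finite_network G" "neighbour_order (verts G) (edges G) nb" "u \<in> verts G"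
  shows "(\<Sum>(a, b)\<in>{(a, b) \<in> edges G. a = u \<or> b = u}. epot G (a, b) (z a) (z b))
       = (\<Sum>v\<in>set (nb (verts G) u). interaction G u v (z u) (z v))"
proof -
  define f where "f v = (if (u, v) \<in> edges G then (u, v) else (v, u))" for v
  note fin = finite_networkD[OF assms(1)]
  have asym: "\<And>a b. (a, b) \<in> edges G \<Longrightarrow> (b, a) \<notin> edges G"
    using fin(4) by (rule asymD)
  have S: "set (nb (verts G) u) = {v. (u, v) \<in> edges G \<or> (v, u) \<in> edges G}"
    using neighbour_orderD[OF assms(2,3)] fin(3) by auto
  have "inj_on f {v. (u, v) \<in> edges G \<or> (v, u) \<in> edges G}"
    using asym by (auto simp: inj_on_def f_def split: if_splits)
  moreover have "{(a, b) \<in> edges G. a = u \<or> b = u} = f ` {v. (u, v) \<in> edges G \<or> (v, u) \<in> edges G}"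
    using asym by (auto simp: f_def image_iff)
  ultimately show ?thesis
    unfolding S by (simp only: sum.reindex) (auto simp: f_def interaction_def intro!: sum.cong)
qed

lemma sum_set_nth:
  assumes "distinct vs"
  shows "sum f (set vs) = (\<Sum>i<length vs. f (vs ! i))"
  using sum.reindex_bij_betw[OF bij_betw_nth[OF assms refl refl], of f] by simp

lemma objective_split:
  assumes "finite_network G" "neighbour_order (verts G) (edges G) nb" "u \<in> verts G"
  shows "objective G z = vpot G u (z u) + (objective_without G u z
     + (\<Sum>i<length (nb (verts G) u).
          interaction G u (nb (verts G) u ! i) (z u) (z (nb (verts G) u ! i))))"
proof -
  note fin = finite_networkD[OF assms(1)]
  let ?A = "{(a, b) \<in> edges G. a = u \<or> b = u}" and ?B = "{(a, b) \<in> edges G. a \<noteq> u \<and> b \<noteq> u}"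
  let ?f = "\<lambda>(a, b). epot G (a, b) (z a) (z b)"
  have E: "?A \<union> ?B = edges G" by auto
  have "finite ?A" "finite ?B"
    using fin(2) by (auto intro: finite_subset[of _ "edges G"])
  then have "sum ?f (?A \<union> ?B) = sum ?f ?A + sum ?f ?B"
    by (rule sum.union_disjoint) auto
  then have "sum ?f (edges G) = sum ?f ?A + sum ?f ?B"
    unfolding E .
  moreover have "(\<Sum>v\<in>verts G. vpot G v (z v))
      = vpot G u (z u) + (\<Sum>v\<in>verts G - {u}. vpot G v (z v))"
    using fin(1) assms(3) by (rule sum.remove)
  ultimately show ?thesis
    unfolding objective_def objective_without_def sum_incident_edges[OF assms]
      sum_set_nth[OF neighbour_orderD(1)[OF assms(2,3)]]
    by (simp add: ac_simps)
qed

lemma objective_subnetwork: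
  fixes G :: "'v network"
  assumes "finite_network G" "neighbour_order (verts G) (edges G) nb" "u \<in> verts G"
    and vs: "vs = nb (verts G) u" and j: "j < length vs"
  shows "objective (subnetwork nb G u j x) z = objective_without G u z
     + (\<Sum>i\<in>{..<length vs} - {j}. interaction G u (vs ! i) (if i < j then x else 0) (z (vs ! i)))"
proof -
  note fin = finite_networkD[OF assms(1)]
  have dist: "distinct vs" and set: "set vs = {v \<in> verts G. (u, v) \<in> edges G \<or> (v, u) \<in> edges G}"
    using neighbour_orderD[OF assms(2,3)] vs by auto
  have sub: "set vs \<subseteq> verts G - {u}"
    unfolding vs by (rule neighbours_remaining[OF assms(2) fin(4) assms(3)])
  define h where "h v = (if v \<in> set (take j vs) then interaction G u v x (z v)
      else if v \<in> set (drop (Suc j) vs) then interaction G u v 0 (z v) else 0)" for v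
  have "(\<Sum>v\<in>verts G - {u}. vpot (subnetwork nb G u j x) v (z v))
      = (\<Sum>v\<in>verts G - {u}. vpot G v (z v) + h v)"
    by (intro sum.cong) (auto simp: subnetwork_def Let_def h_def vs)
  also have "\<dots> = (\<Sum>v\<in>verts G - {u}. vpot G v (z v)) + (\<Sum>v\<in>verts G - {u}. h v)"
    by (rule sum.distrib)
  also have "(\<Sum>v\<in>verts G - {u}. h v) = (\<Sum>v\<in>set vs. h v)"
    using fin(1) sub
    by (intro sum.mono_neutral_right) (auto simp: h_def dest: in_set_takeD in_set_dropD)
  also have "\<dots> = (\<Sum>i<length vs. h (vs ! i))"
    by (rule sum_set_nth[OF dist])
  also have "\<dots> = (\<Sum>i\<in>{..<length vs} - {j}. h (vs ! i))"
  proof (intro sum.mono_neutral_right ballI)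
    have "vs ! j \<notin> set (take j vs)" "vs ! j \<notin> set (drop (Suc j) vs)"
      using dist j by (auto simp: in_set_conv_nth nth_eq_iff_index_eq)
    then show "h (vs ! i) = 0" if "i \<in> {..<length vs} - ({..<length vs} - {j})" for i
      using that by (auto simp: h_def)
  qed auto
  also have "\<dots> = (\<Sum>i\<in>{..<length vs} - {j}.
      interaction G u (vs ! i) (if i < j then x else 0) (z (vs ! i)))"
  proof (rule sum.cong[OF refl])
    fix i assume i: "i \<in> {..<length vs} - {j}"
    show "h (vs ! i) = interaction G u (vs ! i) (if i < j then x else 0) (z (vs ! i))"
    proof (cases "i < j")
      case True
      then have "vs ! i \<in> set (take j vs)" using i j by (auto simp: in_set_conv_nth)
      then show ?thesis using True by (simp add: h_def)
    next
      case False
      then have "vs ! i \<in> set (drop (Suc j) vs)"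
        using i j by (auto simp: in_set_conv_nth intro!: exI[of _ "i - Suc j"])
      moreover have "vs ! i \<notin> set (take j vs)"
        using False i dist j by (auto simp: in_set_conv_nth nth_eq_iff_index_eq)
      ultimately show ?thesis using False by (simp add: h_def)
    qed
  qed
  finally show ?thesis
    unfolding objective_def objective_without_def by (simp add: add.assoc)
qed

text \<open>
  Two consecutive hybrids differ only in what the neighbour number \<open>j\<close> sees, and what remains after
  removing its interaction with \<open>u\<close> is precisely the objective of the subnetwork \<open>G(u, j, x)\<close>.
\<close>

lemma hybrid_objective_step:
  assumes "finite_network G" "neighbour_order (verts G) (edges G) nb" "u \<in> verts G"
    and vs: "vs = nb (verts G) u" and j: "j < length vs"
  shows "hybrid_objective G u vs x (Suc j) z
      = interaction G u (vs ! j) x (z (vs ! j)) + objective (subnetwork nb G u j x) z"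
    and "hybrid_objective G u vs x j z
      = interaction G u (vs ! j) 0 (z (vs ! j)) + objective (subnetwork nb G u j x) z"
proof -
  have *: "(\<Sum>i<length vs. f i) = f j + (\<Sum>i\<in>{..<length vs} - {j}. f i)" for f :: "nat \<Rightarrow> ereal"
    using j by (intro sum.remove) auto
  have "(\<Sum>i\<in>{..<length vs} - {j}. interaction G u (vs ! i) (if i < Suc j then x else 0) (z (vs ! i)))
     = (\<Sum>i\<in>{..<length vs} - {j}. interaction G u (vs ! i) (if i < j then x else 0) (z (vs ! i)))"
    by (intro sum.cong) auto
  then show "hybrid_objective G u vs x (Suc j) z
      = interaction G u (vs ! j) x (z (vs ! j)) + objective (subnetwork nb G u j x) z"
    "hybrid_objective G u vs x j z
      = interaction G u (vs ! j) 0 (z (vs ! j)) + objective (subnetwork nb G u j x) z"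
    unfolding hybrid_objective_def objective_subnetwork[OF assms] *
    by (simp_all add: ac_simps)
qed

text \<open>
  Used for the two extreme hybrids: with all neighbours seeing \<open>a = x\<close>, and with all of them seeing
  \<open>a = 0\<close>.  The hypothesis on \<open>k\<close> covers both.
\<close>

lemma max_objective_hybrid:
  fixes G :: "'v network"
  assumes "finite_network G" "neighbour_order (verts G) (edges G) nb" "u \<in> verts G" "a < nact G"
    and vs: "vs = nb (verts G) u"
    and k: "\<And>i. i < length vs \<Longrightarrow> (if i < k then x else 0) = a"
  shows "max_objective G u a = vpot G u a
     + Max (hybrid_objective G u vs x k ` ((verts G - {u}) \<rightarrow>\<^sub>E {..<nact G}))"
proof -
  note fin = finite_networkD[OF assms(1)]
  let ?S = "(verts G - {u}) \<rightarrow>\<^sub>E {..<nact G}"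
  have S: "finite ?S" "?S \<noteq> {}" using fin by (auto intro!: finite_PiE simp: PiE_eq_empty_iff)
  have sub: "set vs \<subseteq> verts G - {u}"
    unfolding vs by (rule neighbours_remaining[OF assms(2) fin(4) assms(3)])
  have insS: "solutions G = insert u (verts G - {u}) \<rightarrow>\<^sub>E {..<nact G}"
    by (simp only: solutions_def insert_Diff[OF assms(3)])
  \<comment> \<open>Solutions with action \<open>a\<close> at \<open>u\<close> are the extensions of solutions on the other nodes.\<close>
  have solS: "{z \<in> solutions G. z u = a} = (\<lambda>z. z(u := a)) ` ?S" (is "?L = ?R")
  proof
    show "?R \<subseteq> ?L"
    proof
      fix z assume "z \<in> ?R"
      then obtain z' where z': "z' \<in> ?S" "z = z'(u := a)" by blast
      have "z'(u := a) \<in> solutions G"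
        unfolding insS by (rule PiE_fun_upd[OF _ z'(1)]) (use assms(4) in simp)
      then show "z \<in> ?L" using z'(2) by simp
    qed
    show "?L \<subseteq> ?R"
    proof
      fix z assume z: "z \<in> ?L"
      have "z(u := undefined) \<in> ?S" 
        by (rule fun_upd_in_PiE) (use z in \<open>auto simp only: insS\<close>)
      moreover have "z = (z(u := undefined))(u := a)" using z by auto
      ultimately show "z \<in> ?R" by blast
    qed
  qed
  have eq: "objective G (z(u := a)) = vpot G u a + hybrid_objective G u vs x k z" for z
  proof -
    have "objective_without G u (z(u := a)) = objective_without G u z"
      unfolding objective_without_def by (intro arg_cong2[of _ _ _ _ "(+)"] sum.cong) auto
    moreover have "(\<Sum>i<length vs. interaction G u (vs ! i) a ((z(u := a)) (vs ! i)))
        = (\<Sum>i<length vs. interaction G u (vs ! i) (if i < k then x else 0) (z (vs ! i)))"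
    proof (rule sum.cong[OF refl])
      fix i assume i: "i \<in> {..<length vs}"
      then have "vs ! i \<noteq> u" using sub nth_mem by blast
      then show "interaction G u (vs ! i) a ((z(u := a)) (vs ! i))
          = interaction G u (vs ! i) (if i < k then x else 0) (z (vs ! i))"
        using k[of i] i by simp
    qed
    ultimately show ?thesis
      unfolding objective_split[OF assms(1-3)] hybrid_objective_def vs[symmetric] by simp
  qed
  show ?thesis
    unfolding max_objective_def solS image_image eq Max_add_left_ereal[OF S] ..
qed

lemma Max_by_neighbour_action:
  fixes G :: "'v network"
  assumes "finite_network G" "v \<in> verts H" "nact H = nact G" "verts H = verts G - {u}"
    and h: "\<And>z. h z = c (z v) + objective H z"
  shows "Max (h ` ((verts G - {u}) \<rightarrow>\<^sub>E {..<nact G}))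
       = Max ((\<lambda>y. c y + max_objective H v y) ` {..<nact G})"
proof -
  note fin = finite_networkD[OF assms(1)]
  let ?S = "(verts G - {u}) \<rightarrow>\<^sub>E {..<nact G}"
  have sol: "solutions H = ?S" using assms by (simp add: solutions_def)
  have finS: "finite ?S" using fin by (auto intro!: finite_PiE)
  have "(\<lambda>z. z v) ` ?S = {..<nact G}"
  proof
    show "(\<lambda>z. z v) ` ?S \<subseteq> {..<nact G}" using assms(2,4) by (auto dest: PiE_mem)
    show "{..<nact G} \<subseteq> (\<lambda>z. z v) ` ?S"
      using solutions_with_action_nonempty[OF assms(2)] unfolding sol assms(3) by fastforce
  qed
  moreover have "{..<nact G} \<noteq> {}" using fin(5) by auto
  ultimately have "Max (h ` ?S) = Max ((\<lambda>y. Max (h ` {z \<in> ?S. z v = y})) ` {..<nact G})"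
    using finS by (intro Max_fibres)
  also have "(\<lambda>y. Max (h ` {z \<in> ?S. z v = y})) ` {..<nact G}
      = (\<lambda>y. c y + max_objective H v y) ` {..<nact G}"
  proof (rule image_cong[OF refl])
    fix y assume y: "y \<in> {..<nact G}"
    have "h ` {z \<in> ?S. z v = y} = (\<lambda>z. c y + objective H z) ` {z \<in> ?S. z v = y}"
      using h by (intro image_cong) auto
    then show "Max (h ` {z \<in> ?S. z v = y}) = c y + max_objective H v y"
      unfolding max_objective_def sol
      using finS solutions_with_action_nonempty[OF assms(2), of y] y
      by (simp add: Max_add_left_ereal sol assms(3))
  qed
  finally show ?thesis .
qed

lemma Max_diff_ereal:
  assumes "0 < (n::nat)"
  shows "Max ((\<lambda>y. c y + (J y - (J0::ereal))) ` {..<n}) = Max ((\<lambda>y. c y + J y) ` {..<n}) - J0"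
proof -
  have eq: "c y + (J y - J0) = - J0 + (c y + J y)" for y
    by (simp add: minus_ereal_def ac_simps)
  have "{..<n} \<noteq> {}" using assms by auto
  from Max_add_left_ereal[OF finite_lessThan this] show ?thesis
    unfolding eq by (simp only: minus_ereal_def add.commute)
qed

text \<open>
  The reason why the cavity expansion computes cavities.  With \<open>N k\<close> the maximum of the hybrid
  objective, \<open>J(x) - J(0)\<close> is a difference of node potentials plus \<open>N d - N 0\<close> for the degree \<open>d\<close>,
  and this telescopes into the differences \<open>N (j + 1) - N j\<close>.  Maximising in each of them first over
  the action \<open>y\<close> of the neighbour number \<open>j\<close> turns it into a difference of two maxima of
  \<open>\<Phi>(\<cdot>, y) + J'(y)\<close>, where \<open>J'\<close> belongs to the subnetwork.  Subtracting \<open>J'(0)\<close> from both maxima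
  replaces \<open>J'\<close> by the cavity of the subnetwork, and a partial cavity is obtained.
\<close>

theorem cavity_recursion:
  assumes "finite_network G" "neighbour_order (verts G) (edges G) nb" "u \<in> verts G" "x < nact G"
  shows "cavity G u x = vpot G u x - vpot G u 0
     + (\<Sum>j<length (nb (verts G) u). partial_cavity G u (nb (verts G) u ! j) x
          (\<lambda>y. cavity (subnetwork nb G u j x) (nb (verts G) u ! j) y))"
proof -
  note fin = finite_networkD[OF assms(1)]
  define vs where "vs = nb (verts G) u"
  have sub: "set vs \<subseteq> verts G - {u}"
    unfolding vs_def by (rule neighbours_remaining[OF assms(2) fin(4) assms(3)])
  let ?S = "(verts G - {u}) \<rightarrow>\<^sub>E {..<nact G}"
  define N where "N k = Max (hybrid_objective G u vs x k ` ?S)" for k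
  have Jx: "max_objective G u x = vpot G u x + N (length vs)"
    unfolding N_def by (rule max_objective_hybrid[OF assms vs_def]) auto
  have J0: "max_objective G u 0 = vpot G u 0 + N 0"
    unfolding N_def by (rule max_objective_hybrid[OF assms(1-3) fin(5) vs_def]) auto
  have Nfin: "is_real (N k)" for k
    unfolding N_def
  proof (rule is_real_Max)
    show "finite ?S" "?S \<noteq> {}" using fin by (auto intro!: finite_PiE simp: PiE_eq_empty_iff)
    fix z assume z: "z \<in> ?S"
    have zv: "\<And>v. v \<in> verts G - {u} \<Longrightarrow> z v < nact G" using z by (auto dest: PiE_mem)
    have nth: "vs ! i \<in> verts G - {u}" "(u, vs ! i) \<in> edges G \<or> (vs ! i, u) \<in> edges G"
      if "i < length vs" for i
      using that sub nth_mem[OF that] neighbour_orderD(2)[OF assms(2,3)] vs_def by auto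
    show "is_real (hybrid_objective G u vs x k z)"
      unfolding hybrid_objective_def objective_without_def
      using fin zv nth assms(4)
      by (intro is_real_add is_real_sum interaction_finite[OF assms(1)]) auto
  qed
  have step: "partial_cavity G u (vs ! j) x (\<lambda>y. cavity (subnetwork nb G u j x) (vs ! j) y)
      = N (Suc j) - N j" if j: "j < length vs" for j
  proof -
    let ?H = "subnetwork nb G u j x"
    have v: "vs ! j \<in> verts ?H" using sub nth_mem[OF j] by auto
    note hyb = hybrid_objective_step[OF assms(1-3) vs_def j]
    have N1: "N (Suc j) = Max ((\<lambda>y. interaction G u (vs ! j) x y + max_objective ?H (vs ! j) y)
        ` {..<nact G})"
      unfolding N_def by (rule Max_by_neighbour_action[OF assms(1) v]) (simp_all add: hyb)
    have N0: "N j = Max ((\<lambda>y. interaction G u (vs ! j) 0 y + max_objective ?H (vs ! j) y)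
        ` {..<nact G})"
      unfolding N_def by (rule Max_by_neighbour_action[OF assms(1) v]) (simp_all add: hyb)
    have "is_real (max_objective ?H (vs ! j) 0)"
      using v fin(5) by (intro max_objective_finite finite_network_subnetwork assms) auto
    then show ?thesis
      unfolding partial_cavity_def cavity_def Max_diff_ereal[OF fin(5)] N1[symmetric] N0[symmetric]
      using Nfin[of j] Nfin[of "Suc j"]
      by (cases "N j"; cases "N (Suc j)"; cases "max_objective ?H (vs ! j) 0")
        (auto simp: is_real_def)
  qed
  obtain n where n: "N = (\<lambda>k. ereal (n k))"
  proof
    show "N = (\<lambda>k. ereal (real_of_ereal (N k)))" using Nfin by (simp add: ereal_real' is_real_def)
  qed
  have "(\<Sum>j<length vs. partial_cavity G u (vs ! j) x
        (\<lambda>y. cavity (subnetwork nb G u j x) (vs ! j) y)) = (\<Sum>j<length vs. N (Suc j) - N j)"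
    by (intro sum.cong) (auto simp: step)
  also have "\<dots> = N (length vs) - N 0"
    by (simp add: n sum_lessThan_telescope)
  finally show ?thesis
    unfolding vs_def[symmetric] cavity_def Jx J0
    using fin(6)[OF assms(3,4)] fin(6)[OF assms(3) fin(5)]
    by (cases "vpot G u x"; cases "vpot G u 0") (auto simp: n is_real_def)
qed

section \<open>The cavity expansion with the true boundary condition\<close>

text \<open>
  The boundary condition that assigns to every call the cavity it is meant to approximate.  Its
  recursion follows that of \<open>CE_boundary\<close>, so that the recursive calls again have the true boundary
  condition of their own network.
\<close>

fun true_boundary ::
    "('v set \<Rightarrow> 'v \<Rightarrow> 'v list) \<Rightarrow> 'v network \<Rightarrow> 'v \<Rightarrow> nat \<Rightarrow> call \<Rightarrow> ereal" where
  "true_boundary nb G u x [] = cavity G u x"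
| "true_boundary nb G u x ((j, y) # p) =
     true_boundary nb (subnetwork nb G u j x) (nb (verts G) u ! j) y p"

theorem CE_boundary_true_boundary:
  assumes "finite_network G" "neighbour_order (verts G) (edges G) nb" "u \<in> verts G" "x < nact G"
  shows "CE_boundary nb G u r x (true_boundary nb G u x) = cavity G u x"
  using assms
proof (induction r arbitrary: G u x)
  case 0
  then show ?case by simp
next
  case (Suc r)
  let ?vs = "nb (verts G) u"
  have "partial_cavity G u (?vs ! j) x
      (\<lambda>y. CE_boundary nb (subnetwork nb G u j x) (?vs ! j) r y
        (\<lambda>p. true_boundary nb G u x ((j, y) # p)))
    = partial_cavity G u (?vs ! j) x (\<lambda>y. cavity (subnetwork nb G u j x) (?vs ! j) y)"
    if j: "j < length ?vs" for j
  proof -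
    have v: "?vs ! j \<in> verts G - {u}"
      using neighbours_remaining[OF Suc.prems(2) finite_networkD(4) Suc.prems(3)] Suc.prems(1)
        nth_mem[OF j] by auto
    have IH: "CE_boundary nb (subnetwork nb G u j x) (?vs ! j) r y
        (true_boundary nb (subnetwork nb G u j x) (?vs ! j) y)
      = cavity (subnetwork nb G u j x) (?vs ! j) y" if "y < nact G" for y
      using v that Suc.prems
      by (intro Suc.IH finite_network_subnetwork) (auto intro: neighbour_order_remove)
    show ?thesis
      unfolding partial_cavity_def
      by (intro arg_cong2[of _ _ _ _ "(-)"] arg_cong[of _ _ Max] image_cong refl) (simp_all add: IH)
  qed
  then show ?case
    unfolding cavity_recursion[OF Suc.prems] CE_boundary.simps by simp
qed

section \<open>Measurability\<close>

text \<open>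
  The sigma-algebra is a parameter of this notion because it is used twice: for the probability space
  itself, and for the smaller sigma-algebra generated by the network of a depth-0 call, with respect to
  which boundary conditions have to be measurable.
\<close>

definition measurable_network ::
    "'w measure \<Rightarrow> ('w \<Rightarrow> 'v network) \<Rightarrow> 'v set \<Rightarrow> ('v \<times> 'v) set \<Rightarrow> nat \<Rightarrow> bool" where
  "measurable_network M G V E T \<longleftrightarrow>
     (\<forall>\<omega>\<in>space M. verts (G \<omega>) = V \<and> edges (G \<omega>) = E \<and> nact (G \<omega>) = T) \<and>
     (\<forall>v\<in>V. \<forall>x<T. (\<lambda>\<omega>. vpot (G \<omega>) v x) \<in> borel_measurable M) \<and>
     (\<forall>e\<in>E. \<forall>x<T. \<forall>y<T. (\<lambda>\<omega>. epot (G \<omega>) e x y) \<in> borel_measurable M)"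

lemma measurable_networkD:
  assumes "measurable_network M G V E T"
  shows "\<And>\<omega>. \<omega> \<in> space M \<Longrightarrow> verts (G \<omega>) = V"
    "\<And>\<omega>. \<omega> \<in> space M \<Longrightarrow> edges (G \<omega>) = E"
    "\<And>\<omega>. \<omega> \<in> space M \<Longrightarrow> nact (G \<omega>) = T"
    "\<And>v x. v \<in> V \<Longrightarrow> x < T \<Longrightarrow> (\<lambda>\<omega>. vpot (G \<omega>) v x) \<in> borel_measurable M"
    "\<And>e x y. e \<in> E \<Longrightarrow> x < T \<Longrightarrow> y < T \<Longrightarrow> (\<lambda>\<omega>. epot (G \<omega>) e x y) \<in> borel_measurable M"
  using assms unfolding measurable_network_def by auto

lemma space_network_sigma [simp]: "space (network_sigma M H) = space M"
  unfolding network_sigma_def by (rule space_measure_of) auto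

lemma measurable_network_network_sigma:
  assumes graph: "\<And>\<omega>. \<omega> \<in> space M \<Longrightarrow> verts (H \<omega>) = V \<and> edges (H \<omega>) = E \<and> nact (H \<omega>) = T"
  shows "measurable_network (network_sigma M H) H V E T"
proof -
  let ?gen = "{{\<omega> \<in> space M. v \<in> verts (H \<omega>) \<and> x < nact (H \<omega>) \<and> vpot (H \<omega>) v x \<in> A} | v x A.
         A \<in> sets borel} \<union>
      {{\<omega> \<in> space M. e \<in> edges (H \<omega>) \<and> x < nact (H \<omega>) \<and> y < nact (H \<omega>) \<and>
           epot (H \<omega>) e x y \<in> A} | e x y A. A \<in> sets borel}"
  have sets: "sets (network_sigma M H) = sigma_sets (space M) ?gen"
    unfolding network_sigma_def by (rule sets_measure_of) auto
  have v: "(\<lambda>\<omega>. vpot (H \<omega>) v x) \<in> borel_measurable (network_sigma M H)"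
    if "v \<in> V" "x < T" for v x
  proof (rule measurableI)
    fix A :: "ereal set" assume A: "A \<in> sets borel"
    have "(\<lambda>\<omega>. vpot (H \<omega>) v x) -` A \<inter> space M
        = {\<omega> \<in> space M. v \<in> verts (H \<omega>) \<and> x < nact (H \<omega>) \<and> vpot (H \<omega>) v x \<in> A}"
      using that graph by auto
    also have "\<dots> \<in> ?gen" using A by blast
    finally show "(\<lambda>\<omega>. vpot (H \<omega>) v x) -` A \<inter> space (network_sigma M H)
        \<in> sets (network_sigma M H)"
      unfolding sets by (simp add: sigma_sets.Basic)
  qed auto
  have e: "(\<lambda>\<omega>. epot (H \<omega>) e x y) \<in> borel_measurable (network_sigma M H)"
    if "e \<in> E" "x < T" "y < T" for e x y
  proof (rule measurableI)
    fix A :: "ereal set" assume A: "A \<in> sets borel"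
    have "(\<lambda>\<omega>. epot (H \<omega>) e x y) -` A \<inter> space M = {\<omega> \<in> space M. e \<in> edges (H \<omega>) \<and>
        x < nact (H \<omega>) \<and> y < nact (H \<omega>) \<and> epot (H \<omega>) e x y \<in> A}"
      using that graph by auto
    also have "\<dots> \<in> ?gen" using A by blast
    finally show "(\<lambda>\<omega>. epot (H \<omega>) e x y) -` A \<inter> space (network_sigma M H)
        \<in> sets (network_sigma M H)"
      unfolding sets by (simp add: sigma_sets.Basic)
  qed auto
  show ?thesis
    using graph v e unfolding measurable_network_def by simp
qed

lemma measurable_cavity:
  assumes G: "measurable_network M G V E T" and "E \<subseteq> V \<times> V" "finite V"
  shows "(\<lambda>\<omega>. cavity (G \<omega>) v a) \<in> borel_measurable M"
proof -
  note net = measurable_networkD[OF G]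
  let ?S = "V \<rightarrow>\<^sub>E {..<T}"
  define F where "F \<omega> z = (\<Sum>e\<in>E. epot (G \<omega>) e (z (fst e)) (z (snd e)))
    + (\<Sum>v\<in>V. vpot (G \<omega>) v (z v))" for \<omega> z
  have F: "(\<lambda>\<omega>. F \<omega> z) \<in> borel_measurable M" if "z \<in> ?S" for z
  proof -
    have "z v < T" if "v \<in> V" for v using PiE_mem[OF \<open>z \<in> ?S\<close> that] by simp
    then show ?thesis
      unfolding F_def using assms(2) net(4,5)
      by (intro borel_measurable_ereal_add borel_measurable_ereal_sum) auto
  qed
  have J: "(\<lambda>\<omega>. max_objective (G \<omega>) v a) \<in> borel_measurable M" for a
  proof -
    have "(\<lambda>\<omega>. Max (F \<omega> ` {z \<in> ?S. z v = a})) \<in> borel_measurable M"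
    proof (rule borel_measurable_Max)
      have "finite ?S" using assms(3) by (intro finite_PiE) auto
      then show "finite {z \<in> ?S. z v = a}" by (rule finite_subset[rotated]) auto
    qed (use F in auto)
    moreover have "max_objective (G \<omega>) v a = Max (F \<omega> ` {z \<in> ?S. z v = a})" if "\<omega> \<in> space M" for \<omega>
      using net(1-3)[OF that]
      unfolding max_objective_def solutions_def objective_def F_def
      by (simp add: case_prod_beta)
    ultimately show ?thesis by (simp cong: measurable_cong)
  qed
  show ?thesis unfolding cavity_def by (intro borel_measurable_ereal_diff J)
qed

lemma measurable_interaction:
  assumes "measurable_network M G V E T" "(u, v) \<in> E \<or> (v, u) \<in> E" "a < T" "b < T"
  shows "(\<lambda>\<omega>. interaction (G \<omega>) u v a b) \<in> borel_measurable M"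
proof -
  note net = measurable_networkD[OF assms(1)]
  have "(\<lambda>\<omega>. if (u, v) \<in> E then epot (G \<omega>) (u, v) a b else epot (G \<omega>) (v, u) b a)
      \<in> borel_measurable M"
    using assms net(5) by (cases "(u, v) \<in> E") auto
  then show ?thesis
    unfolding interaction_def using net(2) by (simp cong: measurable_cong)
qed

lemma measurable_network_subnetwork:
  assumes G: "measurable_network M G V E T" and nb: "neighbour_order V E nb"
    and u: "u \<in> V" and x: "x < T"
  shows "measurable_network M (\<lambda>\<omega>. subnetwork nb (G \<omega>) u j x)
     (V - {u}) {(a, b) \<in> E. a \<noteq> u \<and> b \<noteq> u} T"
proof -
  note net = measurable_networkD[OF G]
  have v: "(\<lambda>\<omega>. vpot (subnetwork nb (G \<omega>) u j x) v y) \<in> borel_measurable M"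
    if "v \<in> V" "y < T" for v y
  proof -
    let ?f = "\<lambda>\<omega>. if v \<in> set (take j (nb V u)) then vpot (G \<omega>) v y + interaction (G \<omega>) u v x y
        else if v \<in> set (drop (Suc j) (nb V u)) then vpot (G \<omega>) v y + interaction (G \<omega>) u v 0 y
        else vpot (G \<omega>) v y"
    have "(\<lambda>\<omega>. vpot (G \<omega>) v y + interaction (G \<omega>) u v a y) \<in> borel_measurable M"
      if "v \<in> set (nb V u)" "a < T" for a
      using that \<open>v \<in> V\<close> \<open>y < T\<close> neighbour_orderD[OF nb u]
      by (intro borel_measurable_ereal_add net(4) measurable_interaction[OF G]) auto
    then have "?f \<in> borel_measurable M"
      using net(4)[OF that] x
      by (cases "v \<in> set (take j (nb V u))"; cases "v \<in> set (drop (Suc j) (nb V u))")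
        (auto dest: in_set_takeD in_set_dropD)
    then show ?thesis
      by (subst measurable_cong[where g = ?f]) (simp_all add: net(1) subnetwork_def Let_def)
  qed
  then show ?thesis
    using net unfolding measurable_network_def by auto
qed

lemma measurable_CE_boundary:
  assumes "measurable_network M G V E T" "neighbour_order V E nb" "asym E" "u \<in> V" "x < T"
    "\<And>p. c p \<in> borel_measurable M"
  shows "(\<lambda>\<omega>. CE_boundary nb (G \<omega>) u r x (\<lambda>p. c p \<omega>)) \<in> borel_measurable M"
  using assms
proof (induction r arbitrary: G V E u x c)
  case 0
  then show ?case by simp
next
  case (Suc r)
  note net = measurable_networkD[OF Suc.prems(1)]
  have T: "0 < T" using Suc.prems(5) by simp
  let ?CE = "\<lambda>j y \<omega>. CE_boundary nb (subnetwork nb (G \<omega>) u j x) (nb V u ! j) r y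
      (\<lambda>p. c ((j, y) # p) \<omega>)"
  have CE: "?CE j y \<in> borel_measurable M" if "j < length (nb V u)" "y < T" for j y
  proof (rule Suc.IH[OF measurable_network_subnetwork[OF Suc.prems(1,2,4,5)]])
    show "neighbour_order (V - {u}) {(a, b) \<in> E. a \<noteq> u \<and> b \<noteq> u} nb"
      using Suc.prems(2) by (rule neighbour_order_remove)
    show "asym {(a, b) \<in> E. a \<noteq> u \<and> b \<noteq> u}"
      using Suc.prems(3) by (auto simp: asym_on_def)
    show "nb V u ! j \<in> V - {u}"
      using neighbours_remaining[OF Suc.prems(2-4)] nth_mem[OF that(1)] by auto
  qed (use that Suc.prems(6) in auto)
  have "(\<lambda>\<omega>. Max ((\<lambda>y. interaction (G \<omega>) u (nb V u ! j) a y + ?CE j y \<omega>) ` {..<T}))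
      \<in> borel_measurable M" if "j < length (nb V u)" "a < T" for j a
  proof (rule borel_measurable_Max)
    fix y assume "y \<in> {..<T}"
    moreover have "(u, nb V u ! j) \<in> E \<or> (nb V u ! j, u) \<in> E"
      using nth_mem[OF that(1)] neighbour_orderD(2)[OF Suc.prems(2,4)] by auto
    ultimately show "(\<lambda>\<omega>. interaction (G \<omega>) u (nb V u ! j) a y + ?CE j y \<omega>) \<in> borel_measurable M"
      using that CE
      by (intro borel_measurable_ereal_add measurable_interaction[OF Suc.prems(1)]) auto
  qed simp
  then have "(\<lambda>\<omega>. vpot (G \<omega>) u x - vpot (G \<omega>) u 0 + (\<Sum>j<length (nb V u).
      Max ((\<lambda>y. interaction (G \<omega>) u (nb V u ! j) x y + ?CE j y \<omega>) ` {..<T})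
      - Max ((\<lambda>y. interaction (G \<omega>) u (nb V u ! j) 0 y + ?CE j y \<omega>) ` {..<T})))
    \<in> borel_measurable M"
    using T Suc.prems(4,5) net(4)
    by (intro borel_measurable_ereal_add borel_measurable_ereal_diff borel_measurable_ereal_sum) auto
  then show ?case
    using net(1,3) by (simp add: partial_cavity_def cong: measurable_cong)
qed

lemma true_boundary_finite:
  assumes "finite_network G" "neighbour_order (verts G) (edges G) nb" "u \<in> verts G" "x < nact G"
    and "p \<in> depth0_calls nb (nact G) (verts G) u r"
  shows "is_real (true_boundary nb G u x p)"
  using assms
proof (induction r arbitrary: G u x p)
  case 0
  then show ?case using cavity_finite by simp
next
  case (Suc r)
  from Suc.prems(5) obtain j y q where p: "p = (j, y) # q"
    and j: "j < length (nb (verts G) u)" and y: "y < nact G"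
    and q: "q \<in> depth0_calls nb (nact G) (verts G - {u}) (nb (verts G) u ! j) r"
    by auto
  have v: "nb (verts G) u ! j \<in> verts G - {u}"
    using neighbours_remaining[OF Suc.prems(2) finite_networkD(4) Suc.prems(3)] Suc.prems(1)
      nth_mem[OF j] by auto
  show ?case
    unfolding p true_boundary.simps
    using v y q Suc.prems
    by (intro Suc.IH finite_network_subnetwork) (auto intro: neighbour_order_remove)
qed

text \<open>
  The graph of the network of a call is deterministic.  Hence each potential of this network is
  measurable with respect to the sigma-algebra generated by the network, and so is its cavity.
\<close>

lemma measurable_true_boundary:
  assumes "\<And>\<omega>. \<omega> \<in> space M \<Longrightarrow> verts (G \<omega>) = V \<and> edges (G \<omega>) = E \<and> nact (G \<omega>) = T"
    and "E \<subseteq> V \<times> V" "finite V"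
    and "p \<in> depth0_calls nb T V u r"
  shows "(\<lambda>\<omega>. true_boundary nb (G \<omega>) u x p)
    \<in> borel_measurable (network_sigma M (\<lambda>\<omega>. call_network nb (G \<omega>) u x p))"
  using assms
proof (induction r arbitrary: G V E u x p)
  case 0
  then show ?case
    using measurable_cavity[OF measurable_network_network_sigma[of M G V E T]] by auto
next
  case (Suc r)
  from Suc.prems(4) obtain j y q where p: "p = (j, y) # q"
    and q: "q \<in> depth0_calls nb T (V - {u}) (nb V u ! j) r"
    by auto
  let ?H = "\<lambda>\<omega>. subnetwork nb (G \<omega>) u j x"
  have "(\<lambda>\<omega>. true_boundary nb (?H \<omega>) (nb V u ! j) y q)
    \<in> borel_measurable (network_sigma M (\<lambda>\<omega>. call_network nb (?H \<omega>) (nb V u ! j) y q))"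
    using Suc.prems q by (intro Suc.IH[of _ "V - {u}" "{(a, b) \<in> E. a \<noteq> u \<and> b \<noteq> u}"]) auto
  also have "network_sigma M (\<lambda>\<omega>. call_network nb (?H \<omega>) (nb V u ! j) y q)
      = network_sigma M (\<lambda>\<omega>. call_network nb (G \<omega>) u x p)"
    unfolding network_sigma_def p using Suc.prems(1)
    by (simp cong: conj_cong)
  finally show ?case
    by (subst measurable_cong[where g = "\<lambda>\<omega>. true_boundary nb (?H \<omega>) (nb V u ! j) y q"])
      (use Suc.prems(1) in \<open>simp_all add: p\<close>)
qed

section \<open>The mean error of the cavity expansion\<close>

lemma measurable_network_random:
  assumes "random_decision_network M G V E T"
  shows "measurable_network M G V E T"
  using assms unfolding random_decision_network_def measurable_network_def by auto

text \<open>
  Correlation decay compares any two boundary conditions.  Here these are the zero boundary condition,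
  which defines the cavity expansion, and the true one, for which its output is almost surely the
  cavity.
\<close>

lemma expected_CE_error:
  assumes rdn: "random_decision_network M G V E T" and nb: "neighbour_order V E nb"
    and fin: "AE \<omega> in M. finite_network (G \<omega>)"
    and decay: "correlation_decay M nb G V T \<rho>"
    and u: "u \<in> V" and x: "x < T" and r: "0 < r"
  shows "(\<integral>\<^sup>+\<omega>. e2ennreal \<bar>CE nb (G \<omega>) u r x - cavity (G \<omega>) u x\<bar> \<partial>M) \<le> ennreal (\<rho> r)"
proof -
  have graph: "verts (G \<omega>) = V \<and> edges (G \<omega>) = E \<and> nact (G \<omega>) = T" if "\<omega> \<in> space M" for \<omega>
    using rdn that unfolding random_decision_network_def by auto
  interpret prob_space M using rdn unfolding random_decision_network_def by simp
  obtain \<omega> where "\<omega> \<in> space M" using not_empty by blast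
  then have VE: "finite V" "E \<subseteq> V \<times> V"
    using rdn unfolding random_decision_network_def decision_network_def by auto
  let ?C = "\<lambda>p \<omega>. true_boundary nb (G \<omega>) u x p"
  have "boundary_condition M nb G V T u r x (\<lambda>p \<omega>. 0)"
    unfolding boundary_condition_def by simp
  moreover have "boundary_condition M nb G V T u r x ?C"
    unfolding boundary_condition_def
  proof (intro ballI conjI)
    fix p assume p: "p \<in> depth0_calls nb T V u r"
    show "?C p \<in> borel_measurable (network_sigma M (\<lambda>\<omega>. call_network nb (G \<omega>) u x p))"
      by (rule measurable_true_boundary[OF graph VE(2,1) p])
    show "AE \<omega> in M. \<bar>?C p \<omega>\<bar> \<noteq> \<infinity>"
      using fin AE_space
    proof eventually_elim
      case (elim \<omega>)
      then show ?case
        using true_boundary_finite[of "G \<omega>" nb u x p r] graph[of \<omega>] nb u x p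
        unfolding is_real_def by auto
    qed
  qed
  ultimately have "(\<integral>\<^sup>+\<omega>. e2ennreal \<bar>CE_boundary nb (G \<omega>) u r x (\<lambda>p. 0)
      - CE_boundary nb (G \<omega>) u r x (\<lambda>p. ?C p \<omega>)\<bar> \<partial>M) \<le> ennreal (\<rho> r)"
    using decay u x r unfolding correlation_decay_def by (auto simp: Suc_le_eq)
  moreover have "AE \<omega> in M. CE_boundary nb (G \<omega>) u r x (\<lambda>p. ?C p \<omega>) = cavity (G \<omega>) u x"
    using fin AE_space
  proof eventually_elim
    case (elim \<omega>)
    then show ?case
      using CE_boundary_true_boundary[of "G \<omega>" nb u x r] graph[of \<omega>] nb u x by auto
  qed
  then have "(\<integral>\<^sup>+\<omega>. e2ennreal \<bar>CE_boundary nb (G \<omega>) u r x (\<lambda>p. 0)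
      - CE_boundary nb (G \<omega>) u r x (\<lambda>p. ?C p \<omega>)\<bar> \<partial>M)
    = (\<integral>\<^sup>+\<omega>. e2ennreal \<bar>CE nb (G \<omega>) u r x - cavity (G \<omega>) u x\<bar> \<partial>M)"
    by (intro nn_integral_cong_AE) (auto simp: CE_def)
  ultimately show ?thesis by simp
qed

section \<open>Maximisers under perturbation\<close>

lemma emeasure_band_le:
  assumes "density_bounded_by M X g" "0 \<le> \<delta>" "0 \<le> g"
  shows "{\<omega> \<in> space M. \<bar>real_of_ereal (X \<omega>)\<bar> \<le> \<delta>} \<in> sets M"
    and "emeasure M {\<omega> \<in> space M. \<bar>real_of_ereal (X \<omega>)\<bar> \<le> \<delta>} \<le> ennreal (2 * \<delta> * g)"
proof -
  from assms obtain f where f: "distributed M lborel (\<lambda>\<omega>. real_of_ereal (X \<omega>)) f"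
    and le: "\<And>t. f t \<le> ennreal g"
    unfolding density_bounded_by_def by auto
  have eq: "{\<omega> \<in> space M. \<bar>real_of_ereal (X \<omega>)\<bar> \<le> \<delta>}
      = (\<lambda>\<omega>. real_of_ereal (X \<omega>)) -` {-\<delta>..\<delta>} \<inter> space M"
    by (auto simp: abs_le_iff simp del: abs_real_of_ereal)
  have "(\<lambda>\<omega>. real_of_ereal (X \<omega>)) \<in> measurable M lborel"
    using f by (rule distributed_measurable)
  then show "{\<omega> \<in> space M. \<bar>real_of_ereal (X \<omega>)\<bar> \<le> \<delta>} \<in> sets M"
    unfolding eq by (rule measurable_sets) simp
  have "emeasure M {\<omega> \<in> space M. \<bar>real_of_ereal (X \<omega>)\<bar> \<le> \<delta>}
      = (\<integral>\<^sup>+t. f t * indicator {-\<delta>..\<delta>} t \<partial>lborel)"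
    unfolding eq by (rule distributed_emeasure[OF f]) simp
  also have "\<dots> \<le> (\<integral>\<^sup>+t. ennreal g * indicator {-\<delta>..\<delta>} t \<partial>lborel)"
    using le by (intro nn_integral_mono mult_right_mono) auto
  also have "\<dots> = ennreal g * ennreal (2 * \<delta>)"
    using assms(2) by (simp add: nn_integral_cmult_indicator)
  finally show "emeasure M {\<omega> \<in> space M. \<bar>real_of_ereal (X \<omega>)\<bar> \<le> \<delta>} \<le> ennreal (2 * \<delta> * g)"
    using assms(2,3) by (simp add: ennreal_mult[symmetric] mult.commute)
qed

lemma emeasure_ge_le_nn_integral:
  fixes X :: "'a \<Rightarrow> ereal"
  assumes [measurable]: "X \<in> borel_measurable M"
    and "(\<integral>\<^sup>+\<omega>. e2ennreal (X \<omega>) \<partial>M) \<le> ennreal b" "0 < c" "0 \<le> b"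
  shows "emeasure M {\<omega> \<in> space M. ereal c \<le> X \<omega>} \<le> ennreal (b / c)"
proof -
  have "{\<omega> \<in> space M. ereal c \<le> X \<omega>} \<subseteq> {\<omega> \<in> space M. 1 \<le> ennreal (1 / c) * e2ennreal (X \<omega>)}"
  proof safe
    fix \<omega> assume "ereal c \<le> X \<omega>"
    then have "ennreal (1 / c) * ennreal c \<le> ennreal (1 / c) * e2ennreal (X \<omega>)"
      using e2ennreal_mono[of "ereal c" "X \<omega>"] by (intro mult_left_mono) auto
    then show "1 \<le> ennreal (1 / c) * e2ennreal (X \<omega>)"
      using assms(3) by (simp add: ennreal_mult[symmetric])
  qed
  then have "emeasure M {\<omega> \<in> space M. ereal c \<le> X \<omega>}
      \<le> emeasure M {\<omega> \<in> space M. 1 \<le> ennreal (1 / c) * e2ennreal (X \<omega>)}"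
    by (intro emeasure_mono) measurable
  also have "\<dots> \<le> ennreal (1 / c) * (\<integral>\<^sup>+\<omega>. e2ennreal (X \<omega>) * indicator (space M) \<omega> \<partial>M)"
    by (intro nn_integral_Markov_inequality) auto
  also have "\<dots> \<le> ennreal (1 / c) * ennreal b"
    using assms(2) by (intro mult_left_mono) (auto cong: nn_integral_cong_simp)
  finally show ?thesis using assms(3,4) by (simp add: ennreal_mult[symmetric])
qed

text \<open>
  If the maximiser \<open>a\<close> of \<open>B\<close> differs from the maximiser \<open>b\<close> of \<open>A\<close>, then
  \<open>0 \<le> B a - B b \<le> (B a - A a) + (A b - B b)\<close>, because \<open>A a \<le> A b\<close>.  So either \<open>B a\<close> and \<open>B b\<close> are
  within \<open>\<epsilon>\<close> of each other, which the bound on the density makes unlikely, or one of the two errors is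
  at least \<open>\<epsilon> / 2\<close>, which is unlikely by Markov's inequality.

  The maximisers need not be measurable functions of the sample point; therefore a measurable event is
  provided outside of which they agree.  The parameter \<open>t\<close> stands for any number not below
  \<open>(g * \<delta>) powr (1 / 4)\<close>.  Keeping it positive allows for \<open>\<delta> = 0\<close>.
\<close>

lemma argmax_unchanged_off_small_event:
  fixes A B :: "nat \<Rightarrow> 'w \<Rightarrow> ereal"
  assumes meas: "\<And>a. a < T \<Longrightarrow> A a \<in> borel_measurable M" "\<And>a. a < T \<Longrightarrow> B a \<in> borel_measurable M"
    and B_real: "AE \<omega> in M. \<forall>a<T. is_real (B a \<omega>)"
    and dens: "\<And>a b. a < T \<Longrightarrow> b < T \<Longrightarrow> a \<noteq> b \<Longrightarrow> density_bounded_by M (\<lambda>\<omega>. B a \<omega> - B b \<omega>) g"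
    and err: "\<And>a. a < T \<Longrightarrow> (\<integral>\<^sup>+\<omega>. e2ennreal \<bar>A a \<omega> - B a \<omega>\<bar> \<partial>M) \<le> ennreal \<delta>"
    and g: "0 < g" and \<delta>: "0 \<le> \<delta>" and t: "0 < t" "g * \<delta> \<le> t ^ 4"
  obtains S where "S \<in> sets M" "emeasure M S \<le> ennreal ((2 * real T * t)\<^sup>2)"
    "AE \<omega> in M. \<omega> \<notin> S \<longrightarrow> (\<forall>a b. is_arg_max (\<lambda>a. B a \<omega>) (\<lambda>a. a < T) a \<longrightarrow>
       is_arg_max (\<lambda>a. A a \<omega>) (\<lambda>a. a < T) b \<longrightarrow> a = b)"
proof -
  \<comment> \<open>This threshold balances the two kinds of events: each of them has probability at most \<open>2 * t\<^sup>2\<close>.\<close>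
  define \<epsilon> where "\<epsilon> = t\<^sup>2 / g"
  have \<epsilon>: "0 < \<epsilon>" unfolding \<epsilon>_def using g t by simp
  define far where "far a = {\<omega> \<in> space M. ereal (\<epsilon> / 2) \<le> \<bar>A a \<omega> - B a \<omega>\<bar>}" for a
  define close where "close = (\<lambda>(a, b). {\<omega> \<in> space M. \<bar>real_of_ereal (B a \<omega> - B b \<omega>)\<bar> \<le> \<epsilon>})"
  define P where "P = {(a, b). a < T \<and> b < T \<and> a \<noteq> b}"
  have P: "finite P" "card P \<le> T\<^sup>2"
  proof -
    have sub: "P \<subseteq> {..<T} \<times> {..<T}" unfolding P_def by auto
    show "finite P" using sub by (rule finite_subset) simp
    show "card P \<le> T\<^sup>2" using card_mono[OF _ sub] by (simp add: power2_eq_square)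
  qed
  have AB[measurable]: "(\<lambda>\<omega>. \<bar>A a \<omega> - B a \<omega>\<bar>) \<in> borel_measurable M" if "a < T" for a
    using meas that by (intro borel_measurable_ereal_abs borel_measurable_ereal_diff)
  have far: "far a \<in> sets M" "emeasure M (far a) \<le> ennreal (2 * t\<^sup>2)" if "a < T" for a
  proof -
    show "far a \<in> sets M" unfolding far_def using AB[OF that] by measurable
    have "emeasure M (far a) \<le> ennreal (\<delta> / (\<epsilon> / 2))"
      unfolding far_def using \<epsilon> \<delta> by (intro emeasure_ge_le_nn_integral AB err that) auto
    also have "\<delta> / (\<epsilon> / 2) = 2 * (g * \<delta>) / t\<^sup>2" unfolding \<epsilon>_def by simp
    also have "\<dots> \<le> 2 * t ^ 4 / t\<^sup>2"
      using t by (intro divide_right_mono mult_left_mono) auto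
    also have "\<dots> = 2 * t\<^sup>2" using t by (simp add: power4_eq_xxxx power2_eq_square)
    finally show "emeasure M (far a) \<le> ennreal (2 * t\<^sup>2)" by (simp add: ennreal_leI)
  qed
  have close: "close q \<in> sets M" "emeasure M (close q) \<le> ennreal (2 * t\<^sup>2)" if "q \<in> P" for q
  proof -
    obtain a b where q: "q = (a, b)" by (cases q)
    have d: "density_bounded_by M (\<lambda>\<omega>. B a \<omega> - B b \<omega>) g"
      using dens that unfolding P_def q by auto
    have eq: "2 * \<epsilon> * g = 2 * t\<^sup>2" unfolding \<epsilon>_def using g by simp
    from emeasure_band_le[OF d, of \<epsilon>] \<epsilon> g eq show "close q \<in> sets M"
      "emeasure M (close q) \<le> ennreal (2 * t\<^sup>2)"
      unfolding close_def q by auto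
  qed
  define S where "S = (\<Union>a<T. far a) \<union> (\<Union>q\<in>P. close q)"
  have sets: "(\<Union>a<T. far a) \<in> sets M" "(\<Union>q\<in>P. close q) \<in> sets M"
    using far(1) close(1) P by (auto intro!: sets.finite_UN)
  have "emeasure M S \<le> emeasure M (\<Union>a<T. far a) + emeasure M (\<Union>q\<in>P. close q)"
    unfolding S_def using sets by (rule emeasure_subadditive)
  also have "\<dots> \<le> (\<Sum>a<T. emeasure M (far a)) + (\<Sum>q\<in>P. emeasure M (close q))"
    using far(1) close(1) P by (intro add_mono emeasure_subadditive_finite) auto
  also have "\<dots> \<le> (\<Sum>a<T. ennreal (2 * t\<^sup>2)) + (\<Sum>q\<in>P. ennreal (2 * t\<^sup>2))"
    using far(2) close(2) by (intro add_mono sum_mono) auto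
  also have "\<dots> = ennreal (real T * (2 * t\<^sup>2) + real (card P) * (2 * t\<^sup>2))"
    by (simp add: ennreal_of_nat_eq_real_of_nat ennreal_mult'[symmetric] ennreal_plus[symmetric]
        del: ennreal_plus)
  also have "\<dots> \<le> ennreal ((2 * real T * t)\<^sup>2)"
  proof (rule ennreal_leI)
    have "T \<le> T\<^sup>2" by (cases T) (auto simp: power2_eq_square)
    then have "real T \<le> (real T)\<^sup>2" "real (card P) \<le> (real T)\<^sup>2"
      using P(2) by (auto simp flip: of_nat_power)
    then have "real T * (2 * t\<^sup>2) + real (card P) * (2 * t\<^sup>2)
        \<le> (real T)\<^sup>2 * (2 * t\<^sup>2) + (real T)\<^sup>2 * (2 * t\<^sup>2)"
      by (intro add_mono mult_right_mono) auto
    then show "real T * (2 * t\<^sup>2) + real (card P) * (2 * t\<^sup>2) \<le> (2 * real T * t)\<^sup>2"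
      by (simp add: power_mult_distrib mult.commute mult.left_commute)
  qed
  finally have "emeasure M S \<le> ennreal ((2 * real T * t)\<^sup>2)" .
  moreover have "AE \<omega> in M. \<omega> \<notin> S \<longrightarrow> (\<forall>a b. is_arg_max (\<lambda>a. B a \<omega>) (\<lambda>a. a < T) a \<longrightarrow>
       is_arg_max (\<lambda>a. A a \<omega>) (\<lambda>a. a < T) b \<longrightarrow> a = b)"
    using B_real AE_space
  proof (eventually_elim, intro impI allI)
    fix \<omega> a b
    assume real: "\<forall>a<T. is_real (B a \<omega>)" and \<omega>: "\<omega> \<in> space M" "\<omega> \<notin> S"
      and a: "is_arg_max (\<lambda>a. B a \<omega>) (\<lambda>a. a < T) a"
      and b: "is_arg_max (\<lambda>a. A a \<omega>) (\<lambda>a. a < T) b"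
    from a b have ab: "a < T" "b < T" "B b \<omega> \<le> B a \<omega>" "A a \<omega> \<le> A b \<omega>"
      unfolding is_arg_max_linorder by blast+
    have near: "\<bar>A a \<omega> - B a \<omega>\<bar> < ereal (\<epsilon> / 2)" "\<bar>A b \<omega> - B b \<omega>\<bar> < ereal (\<epsilon> / 2)"
      using \<omega> ab(1,2) unfolding S_def far_def by (auto simp: not_le)
    show "a = b"
    proof (rule ccontr)
      assume "a \<noteq> b"
      then have "\<epsilon> < \<bar>real_of_ereal (B a \<omega> - B b \<omega>)\<bar>"
        using \<omega> ab(1,2) unfolding S_def P_def close_def by force
      moreover obtain p where p: "B a \<omega> = ereal p"
        using real ab(1) unfolding is_real_def by (cases "B a \<omega>") auto
      moreover obtain q where q: "B b \<omega> = ereal q"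
        using real ab(2) unfolding is_real_def by (cases "B b \<omega>") auto
      moreover obtain c where "A a \<omega> = ereal c" using near(1) p by (cases "A a \<omega>") auto
      moreover obtain d where "A b \<omega> = ereal d" using near(2) q by (cases "A b \<omega>") auto
      ultimately have "\<epsilon> < \<bar>p - q\<bar>" "\<bar>c - p\<bar> < \<epsilon> / 2" "\<bar>d - q\<bar> < \<epsilon> / 2"
          "q \<le> p" "c \<le> d"
        using near ab(3,4) by simp_all
      then show False by linarith
    qed
  qed
  ultimately show thesis
    using that[of S] sets unfolding S_def by auto
qed

section \<open>The expected cost of wrong decisions\<close>

lemma e2ennreal_abs_square: "e2ennreal (\<bar>a\<bar> ^ 2) = (e2ennreal \<bar>a\<bar>) ^ 2"
  by (cases a) (simp_all add: power2_eq_square ennreal_mult[symmetric] ennreal_top_mult)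

lemma L2_bounded_real:
  assumes "finite I" "\<And>i. i \<in> I \<Longrightarrow> X i \<in> borel_measurable M" "L2_bounded_by M I X K"
  shows "AE \<omega> in M. \<forall>i\<in>I. is_real (X i \<omega>)"
proof (rule AE_finite_allI[OF assms(1)])
  fix i assume i: "i \<in> I"
  have [measurable]: "X i \<in> borel_measurable M" by (rule assms(2)[OF i])
  have "(\<integral>\<^sup>+\<omega>. e2ennreal (\<bar>X i \<omega>\<bar> ^ 2) \<partial>M)
      \<le> (\<Sum>i\<in>I. \<integral>\<^sup>+\<omega>. e2ennreal (\<bar>X i \<omega>\<bar> ^ 2) \<partial>M)"
    using assms(1) i by (intro member_le_sum) auto
  also have "\<dots> < \<infinity>" using assms(3) unfolding L2_bounded_by_def by simp
  finally have "(\<integral>\<^sup>+\<omega>. e2ennreal (\<bar>X i \<omega>\<bar> ^ 2) \<partial>M) \<noteq> \<infinity>" by simp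
  then have "AE \<omega> in M. e2ennreal (\<bar>X i \<omega>\<bar> ^ 2) \<noteq> \<infinity>"
    unfolding e2ennreal_abs_square by (intro nn_integral_noteq_infinite) auto
  then show "AE \<omega> in M. is_real (X i \<omega>)"
    unfolding e2ennreal_abs_square is_real_def
    by eventually_elim (auto simp: power2_eq_square)
qed

text \<open>
  By the Cauchy--Schwarz inequality, since the square of the maximum is at most the sum of the squares.
\<close>

lemma nn_integral_Max_on_event:
  fixes X :: "'i \<Rightarrow> 'w \<Rightarrow> ereal"
  assumes I: "finite I" "I \<noteq> {}" and meas: "\<And>i. i \<in> I \<Longrightarrow> X i \<in> borel_measurable M"
    and L2: "L2_bounded_by M I X K" and S: "S \<in> sets M" "emeasure M S \<le> ennreal (q\<^sup>2)" and q: "0 \<le> q"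
  shows "(\<integral>\<^sup>+\<omega>. Max ((\<lambda>i. e2ennreal \<bar>X i \<omega>\<bar>) ` I) * indicator S \<omega> \<partial>M) \<le> ennreal (K * q)"
    and "(\<lambda>\<omega>. Max ((\<lambda>i. e2ennreal \<bar>X i \<omega>\<bar>) ` I)) \<in> borel_measurable M"
proof -
  let ?m = "\<lambda>\<omega>. Max ((\<lambda>i. e2ennreal \<bar>X i \<omega>\<bar>) ` I)"
  let ?L = "\<Sum>i\<in>I. \<integral>\<^sup>+\<omega>. e2ennreal (\<bar>X i \<omega>\<bar> ^ 2) \<partial>M"
  have Xm: "(\<lambda>\<omega>. e2ennreal \<bar>X i \<omega>\<bar>) \<in> borel_measurable M" if "i \<in> I" for i
    using meas[OF that] by measurable
  show m[measurable]: "?m \<in> borel_measurable M"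
    using I(1) Xm by (rule borel_measurable_Max)
  note [measurable] = S(1)
  have L: "?L < \<infinity>" "sqrt (enn2real ?L) \<le> K" using L2 unfolding L2_bounded_by_def by auto
  have K: "0 \<le> K" using L(2) by (rule order_trans[rotated]) simp
  have "?L = ennreal (enn2real ?L)" by (rule ennreal_enn2real[symmetric]) (use L(1) in simp)
  also have "\<dots> \<le> ennreal (K\<^sup>2)" using L(2) by (intro ennreal_leI sqrt_le_D)
  finally have LK: "?L \<le> ennreal (K\<^sup>2)" .
  have "(\<integral>\<^sup>+\<omega>. (?m \<omega>)\<^sup>2 \<partial>M) \<le> (\<integral>\<^sup>+\<omega>. (\<Sum>i\<in>I. e2ennreal (\<bar>X i \<omega>\<bar> ^ 2)) \<partial>M)"
  proof (rule nn_integral_mono)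
    fix \<omega>
    have "?m \<omega> \<in> (\<lambda>i. e2ennreal \<bar>X i \<omega>\<bar>) ` I" using I by (intro Max_in) auto
    then obtain i where "i \<in> I" "?m \<omega> = e2ennreal \<bar>X i \<omega>\<bar>" by auto
    then show "(?m \<omega>)\<^sup>2 \<le> (\<Sum>i\<in>I. e2ennreal (\<bar>X i \<omega>\<bar> ^ 2))"
      using I member_le_sum[of i I "\<lambda>i. e2ennreal (\<bar>X i \<omega>\<bar> ^ 2)"]
      by (simp add: e2ennreal_abs_square)
  qed
  also have "\<dots> = ?L"
    using Xm unfolding e2ennreal_abs_square by (intro nn_integral_sum) auto
  finally have m2: "(\<integral>\<^sup>+\<omega>. (?m \<omega>)\<^sup>2 \<partial>M) \<le> ennreal (K\<^sup>2)" using LK by simp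
  have "(\<integral>\<^sup>+\<omega>. ?m \<omega> * indicator S \<omega> \<partial>M)\<^sup>2
      \<le> (\<integral>\<^sup>+\<omega>. (?m \<omega>)\<^sup>2 \<partial>M) * (\<integral>\<^sup>+\<omega>. (indicator S \<omega>)\<^sup>2 \<partial>M)"
    by (rule Cauchy_Schwarz_nn_integral) measurable
  also have "(\<integral>\<^sup>+\<omega>. (indicator S \<omega> :: ennreal)\<^sup>2 \<partial>M) = (\<integral>\<^sup>+\<omega>. indicator S \<omega> \<partial>M)"
    by (intro nn_integral_cong) (simp add: indicator_def)
  also have "\<dots> = emeasure M S" by simp
  also have "(\<integral>\<^sup>+\<omega>. (?m \<omega>)\<^sup>2 \<partial>M) * emeasure M S \<le> ennreal (K\<^sup>2) * ennreal (q\<^sup>2)"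
    using m2 S(2) by (rule mult_mono) auto
  also have "\<dots> = ennreal ((K * q)\<^sup>2)" by (simp add: ennreal_mult[symmetric] power_mult_distrib)
  finally have sq: "(\<integral>\<^sup>+\<omega>. ?m \<omega> * indicator S \<omega> \<partial>M)\<^sup>2 \<le> ennreal ((K * q)\<^sup>2)" .
  show "(\<integral>\<^sup>+\<omega>. ?m \<omega> * indicator S \<omega> \<partial>M) \<le> ennreal (K * q)"
  proof (cases "\<integral>\<^sup>+\<omega>. ?m \<omega> * indicator S \<omega> \<partial>M")
    case (real c)
    have "ennreal (c\<^sup>2) \<le> ennreal ((K * q)\<^sup>2)"
      using sq unfolding real(2) ennreal_power[OF real(1)] .
    then have "c\<^sup>2 \<le> (K * q)\<^sup>2" by (subst (asm) ennreal_le_iff) auto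
    moreover have "0 \<le> K * q" using K q by simp
    ultimately have "c \<le> K * q" by (rule power2_le_imp_le)
    then show ?thesis unfolding real(2) by (rule ennreal_leI)
  next
    case top
    have "top \<le> ennreal ((K * q)\<^sup>2)" using sq unfolding top by (simp add: power2_eq_square)
    then show ?thesis by (simp add: top_unique)
  qed
qed

lemma e2ennreal_add_diff_le:
  assumes "is_real a" "is_real b" "is_real c" "is_real d"
  shows "e2ennreal ((a + b) - (c + d)) \<le> e2ennreal (a - c) + e2ennreal (b - d)"
  using assms
  by (cases a; cases b; cases c; cases d)
    (auto simp: is_real_def ennreal_plus_if ennreal_leI split: if_splits)

lemma e2ennreal_diff_le_abs:
  assumes "is_real a" "is_real b"
  shows "e2ennreal (a - b) \<le> e2ennreal \<bar>a\<bar> + e2ennreal \<bar>b\<bar>"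
  using assms
  by (cases a; cases b) (auto simp: is_real_def ennreal_plus[symmetric] ennreal_leI simp del: ennreal_plus)

lemma e2ennreal_sum_diff_le:
  assumes "\<And>a. a \<in> A \<Longrightarrow> is_real (f a)" "\<And>a. a \<in> A \<Longrightarrow> is_real (h a)"
  shows "e2ennreal (sum f A - sum h A) \<le> (\<Sum>a\<in>A. e2ennreal (f a - h a))"
  using assms
proof (induction A rule: infinite_finite_induct)
  case (insert a A)
  then have "e2ennreal (sum f A - sum h A) \<le> (\<Sum>a\<in>A. e2ennreal (f a - h a))" by auto
  moreover have "is_real (sum f A)" "is_real (sum h A)" using insert by (auto intro: is_real_sum)
  then have "e2ennreal ((f a + sum f A) - (h a + sum h A))
      \<le> e2ennreal (f a - h a) + e2ennreal (sum f A - sum h A)"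
    using insert.prems(1,2)[of a] by (intro e2ennreal_add_diff_le) auto
  ultimately show ?case
    using insert.hyps by (simp add: add_left_mono order_trans)
qed (auto simp: zero_ereal_def)

text \<open>
  Only the nodes in \<open>D\<close> and the edges that touch \<open>D\<close> contribute to the difference, each of them at
  most twice its largest absolute potential.
\<close>

lemma objective_gap_le:
  assumes G: "finite_network G"
    and x: "\<And>v. v \<in> verts G \<Longrightarrow> x v < nact G" and z: "\<And>v. v \<in> verts G \<Longrightarrow> z v < nact G"
    and D: "\<And>v. v \<in> verts G \<Longrightarrow> v \<notin> D \<Longrightarrow> x v = z v"
  shows "e2ennreal (objective G x - objective G z)
    \<le> (\<Sum>e\<in>edges G. 2 * (Max ((\<lambda>(a, b). e2ennreal \<bar>epot G e a b\<bar>) ` ({..<nact G} \<times> {..<nact G}))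
          * indicator {e. fst e \<in> D \<or> snd e \<in> D} e))
      + (\<Sum>v\<in>verts G. 2 * (Max ((\<lambda>a. e2ennreal \<bar>vpot G v a\<bar>) ` {..<nact G}) * indicator D v))"
proof -
  note fin = finite_networkD[OF G]
  let ?I = "{..<nact G} \<times> {..<nact G}"
  let ?e = "\<lambda>y e. epot G e (y (fst e)) (y (snd e))"
  let ?v = "\<lambda>y v. vpot G v (y v)"
  have obj: "objective G y = sum (?e y) (edges G) + sum (?v y) (verts G)" for y
    unfolding objective_def by (simp add: case_prod_beta)
  have ends: "fst e \<in> verts G" "snd e \<in> verts G" if "e \<in> edges G" for e
    using fin(3) that by auto
  have er: "is_real (?e x e)" "is_real (?e z e)" if "e \<in> edges G" for e
    using fin(7) that ends x z by auto
  have vr: "is_real (?v x v)" "is_real (?v z v)" if "v \<in> verts G" for v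
    using fin(6) that x z by auto
  have "e2ennreal (objective G x - objective G z)
      \<le> e2ennreal (sum (?e x) (edges G) - sum (?e z) (edges G))
        + e2ennreal (sum (?v x) (verts G) - sum (?v z) (verts G))"
    unfolding obj using er vr by (intro e2ennreal_add_diff_le is_real_sum) auto
  also have "\<dots> \<le> (\<Sum>e\<in>edges G. e2ennreal (?e x e - ?e z e))
        + (\<Sum>v\<in>verts G. e2ennreal (?v x v - ?v z v))"
    using er vr by (intro add_mono e2ennreal_sum_diff_le) auto
  also have "\<dots> \<le> (\<Sum>e\<in>edges G. 2 * (Max ((\<lambda>(a, b). e2ennreal \<bar>epot G e a b\<bar>) ` ?I)
          * indicator {e. fst e \<in> D \<or> snd e \<in> D} e))
      + (\<Sum>v\<in>verts G. 2 * (Max ((\<lambda>a. e2ennreal \<bar>vpot G v a\<bar>) ` {..<nact G}) * indicator D v))"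
  proof (intro add_mono sum_mono)
    fix e assume e: "e \<in> edges G"
    let ?m = "Max ((\<lambda>(a, b). e2ennreal \<bar>epot G e a b\<bar>) ` ?I)"
    have m: "e2ennreal \<bar>epot G e a b\<bar> \<le> ?m" if "a < nact G" "b < nact G" for a b
      using that by (intro Max_ge) (auto intro!: image_eqI[of _ _ "(a, b)"])
    show "e2ennreal (?e x e - ?e z e) \<le> 2 * (?m * indicator {e. fst e \<in> D \<or> snd e \<in> D} e)"
    proof (cases "fst e \<in> D \<or> snd e \<in> D")
      case True
      have "e2ennreal (?e x e - ?e z e) \<le> e2ennreal \<bar>?e x e\<bar> + e2ennreal \<bar>?e z e\<bar>"
        using er[OF e] by (intro e2ennreal_diff_le_abs)
      also have "\<dots> \<le> ?m + ?m" using x z ends[OF e] by (intro add_mono m) auto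
      finally show ?thesis using True by (simp add: mult_2)
    next
      case False
      then have "?e x e = ?e z e" using D ends[OF e] by simp
      then show ?thesis using er(1)[OF e] by (cases "?e z e") (auto simp: is_real_def)
    qed
  next
    fix v assume v: "v \<in> verts G"
    let ?m = "Max ((\<lambda>a. e2ennreal \<bar>vpot G v a\<bar>) ` {..<nact G})"
    have m: "e2ennreal \<bar>vpot G v a\<bar> \<le> ?m" if "a < nact G" for a
      using that by (intro Max_ge) auto
    show "e2ennreal (?v x v - ?v z v) \<le> 2 * (?m * indicator D v)"
    proof (cases "v \<in> D")
      case True
      have "e2ennreal (?v x v - ?v z v) \<le> e2ennreal \<bar>?v x v\<bar> + e2ennreal \<bar>?v z v\<bar>"
        using vr[OF v] by (intro e2ennreal_diff_le_abs)
      also have "\<dots> \<le> ?m + ?m" using x z v by (intro add_mono m) auto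
      finally show ?thesis using True by (simp add: mult_2)
    next
      case False
      then have "?v x v = ?v z v" using D v by simp
      then show ?thesis using vr(1)[OF v] by (cases "?v z v") (auto simp: is_real_def)
    qed
  qed
  finally show ?thesis .
qed

text \<open>
  A node has a wrong decision on an event of probability at most \<open>(2 * T * t)\<^sup>2\<close>, hence an edge has a
  wrong decision at one of its ends on an event of probability at most \<open>2 * (2 * T * t)\<^sup>2\<close>.  Both
  numbers are at most \<open>(5 * T * t)\<^sup>2\<close>, so that every node and every edge contributes at most
  \<open>2 * K * (5 * T * t)\<close> to the expected loss.
\<close>

lemma expected_objective_gap_le:
  fixes M :: "'w measure" and G :: "'w \<Rightarrow> 'v network"
  assumes rdn: "random_decision_network M G V E T" and nb: "neighbour_order V E nb" and g: "0 < g"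
    and dens: "\<And>v a b. v \<in> V \<Longrightarrow> a < T \<Longrightarrow> b < T \<Longrightarrow> a \<noteq> b \<Longrightarrow>
           density_bounded_by M (\<lambda>\<omega>. cavity (G \<omega>) v a - cavity (G \<omega>) v b) g"
    and L2e: "\<And>e. e \<in> E \<Longrightarrow>
           L2_bounded_by M ({..<T} \<times> {..<T}) (\<lambda>(a, b) \<omega>. epot (G \<omega>) e a b) K"
    and L2v: "\<And>v. v \<in> V \<Longrightarrow> L2_bounded_by M {..<T} (\<lambda>a \<omega>. vpot (G \<omega>) v a) K"
    and opt: "AE \<omega> in M. optimal (G \<omega>) (x \<omega>)"
    and arg: "AE \<omega> in M. \<forall>v\<in>V. is_arg_max (\<lambda>a. CE nb (G \<omega>) v r a) (\<lambda>a. a < T) (z \<omega> v)"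
    and decay: "correlation_decay M nb G V T \<rho>"
    and r: "0 < r" and t: "0 < t" "g * \<rho> r \<le> t ^ 4"
  shows "(\<integral>\<^sup>+\<omega>. e2ennreal (objective (G \<omega>) (x \<omega>) - objective (G \<omega>) (z \<omega>)) \<partial>M)
           \<le> ennreal (10 * K * real T * (real (card V) + real (card E)) * t)"
proof -
  interpret prob_space M using rdn unfolding random_decision_network_def by simp
  have G: "measurable_network M G V E T" using rdn by (rule measurable_network_random)
  note net = measurable_networkD[OF G]
  have dec: "decision_network (G \<omega>)" if "\<omega> \<in> space M" for \<omega>
    using rdn that unfolding random_decision_network_def by auto
  obtain \<omega> where \<omega>: "\<omega> \<in> space M" using not_empty by blast
  have VE: "finite V" "E \<subseteq> V \<times> V" "asym E" "0 < T"
    using dec[OF \<omega>] net(1-3)[OF \<omega>] unfolding decision_network_def by auto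
  have finE: "finite E" using VE(1,2) by (auto intro: finite_subset[of _ "V \<times> V"])
  let ?I = "{..<T} \<times> {..<T}"
  have I: "finite ?I" "?I \<noteq> {}" "finite {..<T}" "{..<T} \<noteq> {}" using VE(4) by auto
  have me: "(\<lambda>(a, b) \<omega>. epot (G \<omega>) e a b) i \<in> borel_measurable M" if "e \<in> E" "i \<in> ?I" for e i
    using net(5)[OF that(1)] that(2) by auto
  have mv: "(\<lambda>\<omega>. vpot (G \<omega>) v a) \<in> borel_measurable M" if "v \<in> V" "a \<in> {..<T}" for v a
    using net(4) that by auto
  have "AE \<omega> in M. \<forall>e\<in>E. \<forall>i\<in>?I. is_real ((\<lambda>(a, b) \<omega>. epot (G \<omega>) e a b) i \<omega>)"
    by (intro AE_finite_allI[OF finE] L2_bounded_real[OF I(1) _ L2e] me)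
  then have fin: "AE \<omega> in M. finite_network (G \<omega>)"
    using AE_space
  proof eventually_elim
    case (elim \<omega>)
    then show ?case using dec net(2,3) by (intro finite_networkI) fastforce+
  qed
  let ?stable = "\<lambda>v \<omega>. \<forall>a b. is_arg_max (\<lambda>a. cavity (G \<omega>) v a) (\<lambda>a. a < T) a \<longrightarrow>
      is_arg_max (\<lambda>a. CE nb (G \<omega>) v r a) (\<lambda>a. a < T) b \<longrightarrow> a = b"
  let ?good = "\<lambda>v S. S \<in> sets M \<and> emeasure M S \<le> ennreal ((2 * real T * t)\<^sup>2) \<and>
      (AE \<omega> in M. \<omega> \<notin> S \<longrightarrow> ?stable v \<omega>)"
  have "\<exists>S. ?good v S" if v: "v \<in> V" for v
  proof (rule argmax_unchanged_off_small_event)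
    show "(\<lambda>\<omega>. CE nb (G \<omega>) v r a) \<in> borel_measurable M" if "a < T" for a
      unfolding CE_def using G nb VE(3) v that by (intro measurable_CE_boundary) auto
    show "(\<lambda>\<omega>. cavity (G \<omega>) v a) \<in> borel_measurable M" for a
      by (rule measurable_cavity[OF G VE(2,1)])
    show "AE \<omega> in M. \<forall>a<T. is_real (cavity (G \<omega>) v a)"
      using fin AE_space
    proof eventually_elim
      case (elim \<omega>)
      then show ?case using net(1,3) v by (auto intro: cavity_finite)
    qed
    show "(\<integral>\<^sup>+\<omega>. e2ennreal \<bar>CE nb (G \<omega>) v r a - cavity (G \<omega>) v a\<bar> \<partial>M) \<le> ennreal (\<rho> r)"
      if "a < T" for a
      by (rule expected_CE_error[OF rdn nb fin decay v that r])
    show "0 \<le> \<rho> r" using decay unfolding correlation_decay_def by auto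
  qed (use dens v g t in blast)+
  then have "\<forall>v\<in>V. \<exists>S. ?good v S" by blast
  then obtain S where "\<forall>v\<in>V. ?good v (S v)"
    using bchoice[of V ?good] by blast
  then have S: "\<And>v. v \<in> V \<Longrightarrow> S v \<in> sets M"
      "\<And>v. v \<in> V \<Longrightarrow> emeasure M (S v) \<le> ennreal ((2 * real T * t)\<^sup>2)"
      "\<And>v. v \<in> V \<Longrightarrow> AE \<omega> in M. \<omega> \<notin> S v \<longrightarrow> ?stable v \<omega>"
    by blast+
  define m where "m e \<omega> = Max ((\<lambda>i. e2ennreal \<bar>(\<lambda>(a, b) \<omega>. epot (G \<omega>) e a b) i \<omega>\<bar>) ` ?I)" for e \<omega>
  define n where "n v \<omega> = Max ((\<lambda>a. e2ennreal \<bar>vpot (G \<omega>) v a\<bar>) ` {..<T})" for v \<omega>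
  let ?S = "\<lambda>e. S (fst e) \<union> S (snd e)"
  have Se: "?S e \<in> sets M" "emeasure M (?S e) \<le> ennreal ((5 * real T * t)\<^sup>2)" if "e \<in> E" for e
  proof -
    have e: "fst e \<in> V" "snd e \<in> V" using VE(2) that by auto
    show "?S e \<in> sets M" using S(1) e by auto
    have "emeasure M (?S e) \<le> emeasure M (S (fst e)) + emeasure M (S (snd e))"
      using S(1) e by (intro emeasure_subadditive)
    also have "\<dots> \<le> ennreal ((2 * real T * t)\<^sup>2) + ennreal ((2 * real T * t)\<^sup>2)"
      using S(2) e by (intro add_mono)
    also have "\<dots> \<le> ennreal ((5 * real T * t)\<^sup>2)"
      by (subst ennreal_plus[symmetric]) (auto intro!: ennreal_leI simp: power_mult_distrib)
    finally show "emeasure M (?S e) \<le> ennreal ((5 * real T * t)\<^sup>2)" .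
  qed
  have Sv: "emeasure M (S v) \<le> ennreal ((5 * real T * t)\<^sup>2)" if "v \<in> V" for v
    using S(2)[OF that] by (rule order_trans) (auto intro!: ennreal_leI simp: power_mult_distrib)
  have q: "0 \<le> 5 * real T * t" using t by simp
  have me_int: "(\<integral>\<^sup>+\<omega>. m e \<omega> * indicator (?S e) \<omega> \<partial>M) \<le> ennreal (K * (5 * real T * t))"
    and me_meas: "m e \<in> borel_measurable M" if "e \<in> E" for e
    unfolding m_def
    using nn_integral_Max_on_event[OF I(1,2) me[OF that] L2e[OF that] Se[OF that] q] by blast+
  have nv_int: "(\<integral>\<^sup>+\<omega>. n v \<omega> * indicator (S v) \<omega> \<partial>M) \<le> ennreal (K * (5 * real T * t))"
    and nv_meas: "n v \<in> borel_measurable M" if "v \<in> V" for v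
    unfolding n_def
    using nn_integral_Max_on_event[OF I(3,4) mv[OF that] L2v[OF that] S(1)[OF that] Sv[OF that] q]
    by blast+
  have "AE \<omega> in M. \<forall>v\<in>V. \<omega> \<notin> S v \<longrightarrow> ?stable v \<omega>"
    using S(3) VE(1) by (intro AE_finite_allI)
  with opt arg fin AE_space have "AE \<omega> in M. e2ennreal (objective (G \<omega>) (x \<omega>) - objective (G \<omega>) (z \<omega>))
      \<le> (\<Sum>e\<in>E. 2 * (m e \<omega> * indicator (?S e) \<omega>)) + (\<Sum>v\<in>V. 2 * (n v \<omega> * indicator (S v) \<omega>))"
  proof eventually_elim
    case (elim \<omega>)
    note [simp] = net(1-3)[OF elim(4)]
    let ?D = "{v. \<omega> \<in> S v}"
    have x: "x \<omega> v < T" if "v \<in> V" for v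
      using elim(1) that solutions_value[of "x \<omega>" "G \<omega>" v]
      unfolding optimal_def is_arg_max_def by simp
    have "is_arg_max (\<lambda>a. cavity (G \<omega>) v a) (\<lambda>a. a < T) (x \<omega> v)" if "v \<in> V" for v
      using optimal_maximizes_cavity[OF elim(3,1)] that x[OF that]
      by (auto simp: is_arg_max_linorder)
    then have eq: "x \<omega> v = z \<omega> v" if "v \<in> V" "v \<notin> ?D" for v
      using elim(2,5) that by blast
    have "e2ennreal (objective (G \<omega>) (x \<omega>) - objective (G \<omega>) (z \<omega>))
      \<le> (\<Sum>e\<in>E. 2 * (Max ((\<lambda>(a, b). e2ennreal \<bar>epot (G \<omega>) e a b\<bar>) ` ?I)
          * indicator {e. fst e \<in> ?D \<or> snd e \<in> ?D} e))
        + (\<Sum>v\<in>V. 2 * (Max ((\<lambda>a. e2ennreal \<bar>vpot (G \<omega>) v a\<bar>) ` {..<T}) * indicator ?D v))"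
      using objective_gap_le[OF elim(3), of "x \<omega>" "z \<omega>" ?D] x eq elim(2)
      by (simp add: is_arg_max_def)
    also have "\<dots> = (\<Sum>e\<in>E. 2 * (m e \<omega> * indicator (?S e) \<omega>))
        + (\<Sum>v\<in>V. 2 * (n v \<omega> * indicator (S v) \<omega>))"
      unfolding m_def n_def
      by (intro arg_cong2[of _ _ _ _ "(+)"] sum.cong refl)
        (auto simp: indicator_def case_prod_beta)
    finally show ?case .
  qed
  then have "(\<integral>\<^sup>+\<omega>. e2ennreal (objective (G \<omega>) (x \<omega>) - objective (G \<omega>) (z \<omega>)) \<partial>M)
      \<le> (\<integral>\<^sup>+\<omega>. (\<Sum>e\<in>E. 2 * (m e \<omega> * indicator (?S e) \<omega>))
          + (\<Sum>v\<in>V. 2 * (n v \<omega> * indicator (S v) \<omega>)) \<partial>M)"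
    by (rule nn_integral_mono_AE)
  also have "\<dots> = (\<integral>\<^sup>+\<omega>. (\<Sum>e\<in>E. 2 * (m e \<omega> * indicator (?S e) \<omega>)) \<partial>M)
      + (\<integral>\<^sup>+\<omega>. (\<Sum>v\<in>V. 2 * (n v \<omega> * indicator (S v) \<omega>)) \<partial>M)"
    using me_meas nv_meas Se(1) S(1)
    by (intro nn_integral_add borel_measurable_sum borel_measurable_times_ennreal
        borel_measurable_indicator) auto
  also have "\<dots> = (\<Sum>e\<in>E. 2 * (\<integral>\<^sup>+\<omega>. m e \<omega> * indicator (?S e) \<omega> \<partial>M))
      + (\<Sum>v\<in>V. 2 * (\<integral>\<^sup>+\<omega>. n v \<omega> * indicator (S v) \<omega> \<partial>M))"
    using me_meas nv_meas Se(1) S(1)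
    by (simp add: nn_integral_sum nn_integral_cmult)
  also have "\<dots> \<le> (\<Sum>e\<in>E. 2 * ennreal (K * (5 * real T * t)))
      + (\<Sum>v\<in>V. 2 * ennreal (K * (5 * real T * t)))"
    using me_int nv_int by (intro add_mono sum_mono mult_left_mono) auto
  also have "\<dots> = ennreal (10 * K * real T * (real (card V) + real (card E)) * t)"
  proof (cases "V = {}")
    \<comment> \<open>Without nodes the sign of \<open>K\<close> is unknown, but both sides vanish.\<close>
    case True
    then show ?thesis using VE(2) by simp
  next
    case False
    then obtain v where "v \<in> V" by blast
    then have "0 \<le> K"
      using L2v[of v] unfolding L2_bounded_by_def by (meson enn2real_nonneg order_trans real_sqrt_ge_zero)
    then have "0 \<le> K * (5 * real T * t)" using t by simp
    then show ?thesis
      using t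
      by (simp add: ennreal_of_nat_eq_real_of_nat ennreal_numeral[symmetric] ennreal_mult'[symmetric] ennreal_plus[symmetric]
          del: ennreal_plus ennreal_numeral) (simp add: algebra_simps)
  qed
  finally show ?thesis .
qed

text \<open>
  The constant is \<open>2 * 5\<close>: a factor \<open>2\<close> for the two solutions that are compared, and the \<open>5\<close> of the
  probability bound \<open>(5 * T * t)\<^sup>2\<close>.
\<close>

theorem theorem7:
  fixes M :: "'w measure"
    and G :: "'w \<Rightarrow> 'v network"
    and V :: "'v set" and E :: "('v \<times> 'v) set" and T :: nat
    and nb :: "'v set \<Rightarrow> 'v \<Rightarrow> 'v list"
    and g K :: real
    and \<rho> :: "nat \<Rightarrow> real"
    and x :: "'w \<Rightarrow> 'v \<Rightarrow> nat"
    and xr :: "nat \<Rightarrow> 'w \<Rightarrow> 'v \<Rightarrow> nat"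
  assumes "random_decision_network M G V E T"
    and "neighbour_order V E nb"
    and "g > 0"
    and "\<And>v a b. v \<in> V \<Longrightarrow> a < T \<Longrightarrow> b < T \<Longrightarrow> a \<noteq> b \<Longrightarrow>
           density_bounded_by M (\<lambda>\<omega>. cavity (G \<omega>) v a - cavity (G \<omega>) v b) g"
    and "\<And>e. e \<in> E \<Longrightarrow>
           L2_bounded_by M ({..<T} \<times> {..<T}) (\<lambda>(a, b) \<omega>. epot (G \<omega>) e a b) K"
    and "\<And>v. v \<in> V \<Longrightarrow> L2_bounded_by M {..<T} (\<lambda>a \<omega>. vpot (G \<omega>) v a) K"
    and "AE \<omega> in M. optimal (G \<omega>) (x \<omega>)"
    and "\<And>r. r > 0 \<Longrightarrow>
           AE \<omega> in M. \<forall>v\<in>V. is_arg_max (\<lambda>a. CE nb (G \<omega>) v r a) (\<lambda>a. a < T) (xr r \<omega> v)"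
    and "correlation_decay M nb G V T \<rho>"
  shows "\<forall>r>0. (\<integral>\<^sup>+\<omega>. e2ennreal (objective (G \<omega>) (x \<omega>) - objective (G \<omega>) (xr r \<omega>)) \<partial>M)
           \<le> ennreal (10 * K * real T * (real (card V) + real (card E)) * (g * \<rho> r) powr (1 / 4))"
proof (intro allI impI)
  fix r :: nat assume r: "0 < r"
  let ?c = "10 * K * real T * (real (card V) + real (card E))"
  let ?s = "(g * \<rho> r) powr (1 / 4)"
  let ?I = "\<integral>\<^sup>+\<omega>. e2ennreal (objective (G \<omega>) (x \<omega>) - objective (G \<omega>) (xr r \<omega>)) \<partial>M"
  have "0 \<le> \<rho> r" using assms(9) unfolding correlation_decay_def by auto
  then have "0 \<le> g * \<rho> r" using assms(3) by simp
  have s4: "?s ^ 4 = g * \<rho> r"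
  proof (cases "g * \<rho> r = 0")
    case True
    show ?thesis unfolding True by simp
  next
    case False
    with \<open>0 \<le> g * \<rho> r\<close> show ?thesis by (simp add: powr_realpow[symmetric] powr_powr)
  qed
  \<comment> \<open>The fourth root \<open>?s\<close> vanishes if \<open>\<rho> r = 0\<close>, so it is approached by positive numbers from above.\<close>
  have "?I \<le> ennreal (?c * (?s + 1 / real (Suc n)))" for n
  proof (rule expected_objective_gap_le[OF assms(1-7) assms(8)[OF r] assms(9) r])
    show "0 < ?s + 1 / real (Suc n)" by (intro add_nonneg_pos) auto
    have "?s ^ 4 \<le> (?s + 1 / real (Suc n)) ^ 4" by (intro power_mono) auto
    then show "g * \<rho> r \<le> (?s + 1 / real (Suc n)) ^ 4" unfolding s4 .
  qed
  moreover have "(\<lambda>n. ennreal (?c * (?s + 1 / real (Suc n)))) \<longlonglongrightarrow> ennreal (?c * (?s + 0))"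
    by (intro tendsto_ennrealI tendsto_mult tendsto_add tendsto_const LIMSEQ_Suc lim_1_over_n)
  ultimately have "?I \<le> ennreal (?c * (?s + 0))"
    by (intro LIMSEQ_le_const) auto
  then show "?I \<le> ennreal (?c * ?s)" by simp
qed

end
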